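(* Let $n\ge2$, let $D$ be a domain in $\overline{\mathbb R^n}=\mathbb R^n\cup\{\infty\}$, and let $\Phi:[0,\infty]\to[0,\infty]$ be a non-decreasing convex function. Suppose that the classes $S^{\Phi}_{M,\Delta}$ are equicontinuous (normal) for all $M\in(0,\infty)$ and all $\Delta\in(0,1)$. Then $$\int_{\delta_*}^{\infty}\frac{d\tau}{\tau\,[\Phi^{-1}(\tau)]^{\frac1{n-1}}}=\infty$$ for all $\delta_*\in(\tau_0,\infty)$, where $\tau_0:=\Phi(0)$.
   Context: Notation: $dm$ is Lebesgue measure. $\overline{\mathbb R^n}$ carries the spherical (chordal) metric $h(x,y)=\frac{|x-y|}{\sqrt{1+|x|^2}\sqrt{1+|y|^2}}$ for $x,y\neq\infty$, $h(x,\infty)=\frac1{\sqrt{1+|x|^2}}$; for a set $E$, $h(E)=\sup_{x_1,x_2\in E}h(x_1,x_2)$. $\Phi$ is convex on $[0,\infty]$ if $\Phi(\lambda t_1+(1-\lambda)t_2)\le\lambda\Phi(t_1)+(1-\lambda)\Phi(t_2)$ for all $t_1,t_2\in[0,\infty]$, $\lambda\in[0,1]$. For non-decreasing $\Phi$, $\Phi^{-1}(\tau)=\inf\{t\in[0,\infty]:\Phi(t)\ge\tau\}$, with $\inf\emptyset=\infty$; $1/\infty=0$, $1/0=\infty$. Inner dilatation: at a point $x$ of differentiability of $f$, with $J(x,f)=\det f'(x)$ and $l(f'(x))=\inf_{v\ne0}|f'(x)v|/|v|$, set $K_I(x,f)=|J(x,f)|/l(f'(x))^n$ if $J(x,f)\ne0$,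 $K_I(x,f)=1$ if $f'(x)=0$, and $K_I(x,f)=\infty$ at all remaining points. Class $S^{\Phi}_{M,\Delta}$: all homeomorphisms (onto their image) $f:D\to\overline{\mathbb R^n}$ of the Sobolev class $W^{1,n}_{loc}$ with $K_I(\cdot,f)$ locally integrable, such that $h(\overline{\mathbb R^n}\setminus f(D))\ge\Delta$ and $$\int_D\Phi(K_I(x,f))\,\frac{dm(x)}{(1+|x|^2)^n}\le M.$$ (Where $\infty\in D$ or $f$ takes the value $\infty$, the local conditions are understood after composing with the inversion $x\mapsto x/|x|^2$.) A family $\mathfrak F$ of mappings $D\to\overline{\mathbb R^n}$ is equicontinuous if at every $x_0\in D$: for every $\varepsilon>0$ there is a neighbourhood $U$ of $x_0$ in $D$ with $h(f(x),f(x_0))<\varepsilon$ for all $x\in U$, $f\in\mathfrak F$. A family of continuous mappings is normal if every sequence in it has a subsequence converging, uniformly (w.r.t. $h$) on each compact subset of $D$, to a continuous mapping $D\to\overline{\mathbb R^n}$; for mappings into the compact space $\overline{\mathbb R^n}$ the two properties are equivalent (Arzelà–Ascoli).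
   Formalization: The domain D is assumed not to be all of the extended space; for D equal to the whole space every class is empty, hence vacuously equicontinuous, and the claim fails, e.g. for Φ(t)=t. *)

theory Defs
  imports "HOL-Analysis.Analysis"
begin

section \<open>The extended space with its chordal metric\<close>

text \<open>The one-point compactification of \<open>real^'n\<close> is the type \<open>(real^'n) option\<close>, where
  \<^term>\<open>None\<close> is the point at infinity.\<close>

fun chordal :: "(real^'n) option \<Rightarrow> (real^'n) option \<Rightarrow> real" where
  "chordal (Some x) (Some y) = norm (x - y) / (sqrt (1 + (norm x)\<^sup>2) * sqrt (1 + (norm y)\<^sup>2))"
| "chordal (Some x) None = 1 / sqrt (1 + (norm x)\<^sup>2)"
| "chordal None (Some y) = 1 / sqrt (1 + (norm y)\<^sup>2)"
| "chordal None None = 0"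

text \<open>The chordal distance is the Euclidean distance of the stereographic images on a sphere of
  diameter 1.\<close>

fun stereo :: "(real^'n) option \<Rightarrow> (real^'n) \<times> real" where
  "stereo (Some x) = (inverse (1 + (norm x)\<^sup>2) *\<^sub>R x, 1 - inverse (1 + (norm x)\<^sup>2))"
| "stereo None = (0, 1)"

lemma chordal_eq_dist_stereo:
  fixes p q :: "(real^'n) option"
  shows "chordal p q = dist (stereo p) (stereo q)"
proof -
  have pos: "1 + (norm z)\<^sup>2 > 0" for z :: "real^'n"
    by (simp add: add_pos_nonneg)
  have SS: "chordal (Some x) (Some y) = dist (stereo (Some x)) (stereo (Some y))" for x y :: "real^'n"
  proof -
    define a where "a = 1 + (norm x)\<^sup>2"
    define b where "b = 1 + (norm y)\<^sup>2"
    have ab: "a > 0" "b > 0" using pos by (auto simp: a_def b_def)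
    have nx: "x \<bullet> x = a - 1" and ny: "y \<bullet> y = b - 1"
      by (auto simp: a_def b_def power2_norm_eq_inner)
    have "(dist (inverse a *\<^sub>R x) (inverse b *\<^sub>R y))\<^sup>2
        = (inverse a)\<^sup>2 * (a - 1) + (inverse b)\<^sup>2 * (b - 1) - 2 * inverse a * inverse b * (x \<bullet> y)"
      unfolding dist_norm power2_norm_eq_inner
      by (simp add: inner_diff_left inner_diff_right nx ny inner_commute[of y x])
         (simp add: power2_eq_square algebra_simps)
    moreover have "(dist (1 - inverse a) (1 - inverse b))\<^sup>2 = (inverse a - inverse b)\<^sup>2"
      by (simp add: dist_real_def power2_commute)
    moreover have "(norm (x - y))\<^sup>2 = a + b - 2 - 2 * (x \<bullet> y)"
      by (simp add: power2_norm_eq_inner inner_diff_left inner_diff_right nx ny inner_commute)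
    moreover have "(inverse a)\<^sup>2 * (a - 1) + (inverse b)\<^sup>2 * (b - 1) - 2 * inverse a * inverse b * (x \<bullet> y)
        + (inverse a - inverse b)\<^sup>2 = (a + b - 2 - 2 * (x \<bullet> y)) / (a * b)"
      using ab by (simp add: field_simps power2_eq_square)
    ultimately have "(dist (inverse a *\<^sub>R x) (inverse b *\<^sub>R y))\<^sup>2 + (dist (1 - inverse a) (1 - inverse b))\<^sup>2
        = (norm (x - y))\<^sup>2 / (a * b)"
      by simp
    then show ?thesis
      by (simp add: dist_Pair_Pair flip: a_def b_def)
         (simp add: real_sqrt_divide real_sqrt_mult)
  qed
  have SN: "chordal (Some x) None = dist (stereo (Some x)) (stereo None)" for x :: "real^'n"
  proof -
    define a where "a = 1 + (norm x)\<^sup>2"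
    have a: "a > 0" using pos by (auto simp: a_def)
    have nx: "(norm x)\<^sup>2 = a - 1" by (simp add: a_def)
    have "(dist (inverse a *\<^sub>R x) 0)\<^sup>2 + (dist (1 - inverse a) 1)\<^sup>2 = 1 / a"
    proof -
      have "(dist (inverse a *\<^sub>R x) 0)\<^sup>2 = (inverse a)\<^sup>2 * (a - 1)"
        using a by (simp add: power_mult_distrib nx)
      moreover have "(dist (1 - inverse a) 1)\<^sup>2 = (inverse a)\<^sup>2"
        using a by (simp add: dist_real_def)
      moreover have "(inverse a)\<^sup>2 * (a - 1) + (inverse a)\<^sup>2 = 1 / a"
        using a by (simp add: field_simps power2_eq_square)
      ultimately show ?thesis by simp
    qed
    then show ?thesis
      by (simp add: dist_Pair_Pair flip: a_def) (simp add: real_sqrt_divide)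
  qed
  show ?thesis
  proof (cases p; cases q)
    fix y assume "p = None" "q = Some y"
    then show ?thesis using SN[of y] by (simp add: dist_commute)
  qed (use SS SN in auto)
qed

lemma inj_stereo:
  fixes p q :: "(real^'n) option"
  shows "stereo p = stereo q \<Longrightarrow> p = q"
proof -
  have pos: "1 + (norm z)\<^sup>2 \<noteq> 0" for z :: "real^'n"
    by (metis add_pos_nonneg less_irrefl zero_le_power2 zero_less_one)
  show "stereo p = stereo q \<Longrightarrow> p = q"
    by (cases p; cases q) (use pos in auto)
qed

interpretation chordal: Metric_space UNIV chordal
proof
  fix x y z :: "(real^'n) option"
  show "(chordal x y = 0) = (x = y)"
    using inj_stereo by (auto simp: chordal_eq_dist_stereo)
  show "chordal x z \<le> chordal x y + chordal y z"
    unfolding chordal_eq_dist_stereo by (rule dist_triangle)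
qed (simp_all add: chordal_eq_dist_stereo dist_commute)

abbreviation xtop :: "(real^'n) option topology" where
  "xtop \<equiv> Metric_space.mtopology UNIV chordal"

definition chordal_diam :: "(real^'n) option set \<Rightarrow> ennreal" where
  "chordal_diam E = (SUP x\<in>E. SUP y\<in>E. ennreal (chordal x y))"

definition xdomain :: "(real^'n) option set \<Rightarrow> bool" where
  "xdomain D \<longleftrightarrow> D \<noteq> {} \<and> openin xtop D \<and> connectedin xtop D"


section \<open>Local coordinates\<close>

fun inversion :: "(real^'n) option \<Rightarrow> (real^'n) option" where
  "inversion (Some x) = (if x = 0 then None else Some ((1 / (norm x)\<^sup>2) *\<^sub>R x))"
| "inversion None = Some 0"

text \<open>Near a finite point \<open>p\<close> the coordinate is the identity, near infinity it is the inversion.\<close>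

definition xchart :: "(real^'n) option \<Rightarrow> real^'n \<Rightarrow> (real^'n) option" where
  "xchart p x = (if p = None then inversion (Some x) else Some x)"

definition xcoord :: "(real^'n) option \<Rightarrow> (real^'n) option \<Rightarrow> real^'n" where
  "xcoord p q = (if p = None then the (inversion q) else the q)"

definition local_rep ::
  "((real^'n) option \<Rightarrow> (real^'n) option) \<Rightarrow> (real^'n) option \<Rightarrow> real^'n \<Rightarrow> real^'n" where
  "local_rep f p x = xcoord (f p) (f (xchart p x))"

text \<open>\<open>U\<close> is a neighbourhood of \<open>p\<close> in its coordinate, inside \<open>D\<close>, on which \<open>local_rep f p\<close>
  represents \<open>f\<close>.\<close>

definition coord_nbhd ::
  "(real^'n) option set \<Rightarrow> ((real^'n) option \<Rightarrow> (real^'n) option) \<Rightarrow> (real^'n) option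
    \<Rightarrow> (real^'n) set \<Rightarrow> bool" where
  "coord_nbhd D f p U \<longleftrightarrow> open U \<and> xcoord p p \<in> U \<and>
     (\<forall>x\<in>U. xchart p x \<in> D \<and> f (xchart p x) \<in> range (xchart (f p)))"


section \<open>Sobolev functions\<close>

primrec Ck :: "nat \<Rightarrow> (real^'n \<Rightarrow> real) \<Rightarrow> bool" where
  "Ck 0 \<phi> \<longleftrightarrow> continuous_on UNIV \<phi>"
| "Ck (Suc k) \<phi> \<longleftrightarrow> (\<forall>x. \<phi> differentiable at x) \<and>
     (\<forall>b\<in>Basis. Ck k (\<lambda>x. frechet_derivative \<phi> (at x) b))"

definition test_fun :: "(real^'n) set \<Rightarrow> (real^'n \<Rightarrow> real) \<Rightarrow> bool" where
  "test_fun U \<phi> \<longleftrightarrow> (\<forall>k. Ck k \<phi>) \<and> compact (closure {x. \<phi> x \<noteq> 0}) \<and> closure {x. \<phi> x \<noteq> 0} \<subseteq> U"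

definition in_Lp :: "nat \<Rightarrow> (real^'n) set \<Rightarrow> (real^'n \<Rightarrow> real^'n) \<Rightarrow> bool" where
  "in_Lp p U g \<longleftrightarrow> set_borel_measurable lebesgue U g \<and>
     (\<integral>\<^sup>+x\<in>U. ennreal (norm (g x) ^ p) \<partial>lebesgue) < \<infinity>"

definition weak_partial ::
  "(real^'n) set \<Rightarrow> real^'n \<Rightarrow> (real^'n \<Rightarrow> real^'n) \<Rightarrow> (real^'n \<Rightarrow> real^'n) \<Rightarrow> bool" where
  "weak_partial U b g G \<longleftrightarrow> (\<forall>\<phi>. test_fun U \<phi> \<longrightarrow>
     (LINT x:U|lebesgue. frechet_derivative \<phi> (at x) b *\<^sub>R g x) = - (LINT x:U|lebesgue. \<phi> x *\<^sub>R G x))"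

definition sobolev_W1 :: "nat \<Rightarrow> (real^'n) set \<Rightarrow> (real^'n \<Rightarrow> real^'n) \<Rightarrow> bool" where
  "sobolev_W1 p U g \<longleftrightarrow> in_Lp p U g \<and>
     (\<forall>b\<in>Basis. \<exists>G. in_Lp p U G \<and> weak_partial U b g G)"

definition W1n_loc ::
  "(real^'n) option set \<Rightarrow> ((real^'n) option \<Rightarrow> (real^'n) option) \<Rightarrow> bool" where
  "W1n_loc D f \<longleftrightarrow>
     (\<forall>p\<in>D. \<exists>U. coord_nbhd D f p U \<and> sobolev_W1 CARD('n) U (local_rep f p))"


section \<open>Inner dilatation\<close>

definition min_stretch :: "(real^'n \<Rightarrow> real^'n) \<Rightarrow> real" where
  "min_stretch A = (INF v\<in>{v. v \<noteq> 0}. norm (A v) / norm v)"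

definition K_I :: "(real^'n \<Rightarrow> real^'n) \<Rightarrow> real^'n \<Rightarrow> ennreal" where
  "K_I g x =
     (if g differentiable at x then
        let A = frechet_derivative g (at x); J = det (matrix A) in
          if J \<noteq> 0 then ennreal (\<bar>J\<bar> / min_stretch A ^ CARD('n))
          else if A = (\<lambda>v. 0) then 1
          else \<infinity>
      else \<infinity>)"

definition xK_I ::
  "((real^'n) option \<Rightarrow> (real^'n) option) \<Rightarrow> (real^'n) option \<Rightarrow> ennreal" where
  "xK_I f p = K_I (local_rep f p) (xcoord p p)"

definition K_I_loc_integrable ::
  "(real^'n) option set \<Rightarrow> ((real^'n) option \<Rightarrow> (real^'n) option) \<Rightarrow> bool" where
  "K_I_loc_integrable D f \<longleftrightarrow>
     (\<forall>p\<in>D. \<exists>U. coord_nbhd D f p U \<and>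
        (\<lambda>x. K_I (local_rep f p) x * indicator U x) \<in> borel_measurable lebesgue \<and>
        (\<integral>\<^sup>+x\<in>U. K_I (local_rep f p) x \<partial>lebesgue) < \<infinity>)"


section \<open>The function classes\<close>

definition S_class ::
  "(real^'n) option set \<Rightarrow> (ennreal \<Rightarrow> ennreal) \<Rightarrow> real \<Rightarrow> real
    \<Rightarrow> ((real^'n) option \<Rightarrow> (real^'n) option) set" where
  "S_class D \<Phi> M \<Delta> = {f.
     embedding_map (subtopology xtop D) xtop f \<and>
     W1n_loc D f \<and> K_I_loc_integrable D f \<and>
     ennreal \<Delta> \<le> chordal_diam (UNIV - f ` D) \<and>
     (\<integral>\<^sup>+x\<in>{x. Some x \<in> D}. \<Phi> (xK_I f (Some x)) * ennreal (1 / (1 + (norm x)\<^sup>2) ^ CARD('n)) \<partial>lebesgue)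
       \<le> ennreal M}"

definition equicontinuous_fam ::
  "(real^'n) option set \<Rightarrow> ((real^'n) option \<Rightarrow> (real^'n) option) set \<Rightarrow> bool" where
  "equicontinuous_fam D F \<longleftrightarrow>
     (\<forall>x0\<in>D. \<forall>\<epsilon>>0. \<exists>U. openin (subtopology xtop D) U \<and> x0 \<in> U \<and>
        (\<forall>x\<in>U. \<forall>f\<in>F. chordal (f x) (f x0) < \<epsilon>))"

definition normal_fam ::
  "(real^'n) option set \<Rightarrow> ((real^'n) option \<Rightarrow> (real^'n) option) set \<Rightarrow> bool" where
  "normal_fam D F \<longleftrightarrow>
     (\<forall>s :: nat \<Rightarrow> (real^'n) option \<Rightarrow> (real^'n) option. range s \<subseteq> F \<longrightarrow>
        (\<exists>(r :: nat \<Rightarrow> nat) g. strict_mono r \<and> continuous_map (subtopology xtop D) xtop g \<and>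
           (\<forall>C. C \<subseteq> D \<and> compactin xtop C \<longrightarrow>
              (\<forall>\<epsilon>>0. \<exists>N. \<forall>k\<ge>N. \<forall>x\<in>C. chordal (s (r k) x) (g x) < \<epsilon>))))"


section \<open>Functions on the extended half-line\<close>

text \<open>In \<^typ>\<open>ennreal\<close> the conventions \<open>0 * \<infinity> = 0\<close>, \<open>1 / 0 = \<infinity>\<close>, \<open>1 / \<infinity> = 0\<close> and
  \<open>Inf {} = \<infinity>\<close> hold.\<close>

definition ext_convex :: "(ennreal \<Rightarrow> ennreal) \<Rightarrow> bool" where
  "ext_convex \<Phi> \<longleftrightarrow> (\<forall>t1 t2. \<forall>l\<in>{0..1::real}.
     \<Phi> (ennreal l * t1 + ennreal (1 - l) * t2) \<le> ennreal l * \<Phi> t1 + ennreal (1 - l) * \<Phi> t2)"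

definition gen_inv :: "(ennreal \<Rightarrow> ennreal) \<Rightarrow> ennreal \<Rightarrow> ennreal" where
  "gen_inv \<Phi> \<tau> = Inf {t. \<Phi> t \<ge> \<tau>}"

text \<open>Power with a positive real exponent.\<close>

definition ennpowr :: "ennreal \<Rightarrow> real \<Rightarrow> ennreal" where
  "ennpowr x a = (if x = \<infinity> then \<infinity> else ennreal (enn2real x powr a))"

end

theory Submission
  imports Defs
begin

text \<open>
  Suppose the integral is finite. Then there is a continuous \<open>v : \<real> \<rightarrow> (0,1]\<close>, integrable at
  \<open>-\<infinity>\<close> and equal to 1 on \<open>[0,\<infinity>)\<close>, such that \<open>\<Phi>(v(s)\<^bsup>1-n\<^esup>)\<close> grows at most like
  \<open>e\<^bsup>-s\<^esup>\<close>: essentially \<open>v(s)\<^bsup>1-n\<^esup> = \<Phi>\<^bsup>-1\<^esup>(e\<^bsup>-s\<^esup>)/2\<close>. A radial stretching whose modulus \<open>\<rho>\<close>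
  satisfies \<open>d log \<rho> / d log r = v(log r)\<close> has inner dilatation \<open>v(log r)\<^bsup>1-n\<^esup>\<close>, so its \<open>\<Phi>\<close>-energy is
  controlled by \<open>1/r\<close>, which is integrable in dimension \<open>n \<ge> 2\<close>; yet \<open>\<rho>\<close> stays away from 0 as
  \<open>r\<close> tends to 0, i.e. the map opens a cavity.

  Such a cavity is opened once at a point missing from \<open>D\<close>, which bounds the omitted set from below even if
  \<open>D\<close> has a single boundary point. Around a point \<open>x0\<close> of \<open>D\<close> the same stretching is used, made
  conformal in the ball of radius \<open>e\<^bsup>-m\<^esup>\<close>. The resulting homeomorphisms lie in one class \<open>S_class D \<Phi> M \<Delta>\<close>
  and move points tending to \<open>x0\<close> to a fixed distance from the image of \<open>x0\<close>.
\<close>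

section \<open>Dilatation profiles\<close>

text \<open>A radial stretching stretches by \<rho>/r along spheres and by w \<rho>/r radially, w
  being its logarithmic derivative. For w \<le> 1 the radial stretch is the least one and the
  Jacobian is w (\<rho>/r)^n, so \<rho> cancels from K_I. Hence the dilatation prescribes w alone,
  and log \<rho> is the integral of w over log r. The substitution \<tau> = 1/r turns the finite
  integral into integrability of w near the centre. The class imposes local conditions only at
  points of D. The missing point may carry a genuine cavity, while at x0 the profile must be raised
  to 1 near the centre; raising w lowers the dilatation, so one energy bound serves all m. As the
  generalized inverse is only monotone and may jump or be infinite, it enters through its values at
  powers of e; a continuous majorant of the resulting step function then gives maps with continuous
  derivative. If the missing point is infinity, the stretching is conjugated by an inversion. The
  pole of order one in the energy becomes linear growth, still integrable for the spherical
  measure.\<close>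

lemma exists_antiderivative:
  fixes v :: "real \<Rightarrow> real"
  assumes v: "continuous_on UNIV v" "\<And>s. 0 \<le> s \<Longrightarrow> v s = 1"
  obtains Q where "\<And>s. (Q has_real_derivative (v s - 1)) (at s)" "\<And>s. 0 \<le> s \<Longrightarrow> Q s = 0"
    "\<And>t. 0 \<le> t \<Longrightarrow> Q (- t) = t - integral {- t..0} v"
proof -
  have "isCont (\<lambda>s. v s - 1) x" for x
    using v(1) by (auto simp: continuous_on_eq_continuous_at intro!: continuous_intros)
  then obtain F where F: "\<And>x. (F has_vector_derivative (v x - 1)) (at x)"
    using einterval_antiderivative[of "-\<infinity>" "\<infinity>" "\<lambda>s. v s - 1"] by auto
  \<comment> \<open>With this normalization \<open>s + Q s\<close> is the antiderivative of
    \<open>v\<close> vanishing at 0. For \<open>s = log r\<close> it is the logarithm of the modulus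
    of the stretching, and \<open>Q s\<close> the logarithm of its ratio to the identity.\<close>
  define Q where "Q s = F s - F 0" for s
  have Q: "(Q has_real_derivative (v s - 1)) (at s)" for s
    unfolding Q_def using F[of s]
    by (auto intro!: derivative_eq_intros simp: has_real_derivative_iff_has_vector_derivative)
  have ftc: "((\<lambda>s. v s - 1) has_integral (Q b - Q a)) {a..b}" if "a \<le> b" for a b
    using that Q by (intro fundamental_theorem_of_calculus)
      (auto simp: has_real_derivative_iff_has_vector_derivative intro: has_vector_derivative_at_within)
  show thesis
  proof
    show "Q s = 0" if "0 \<le> s" for s
    proof -
      have "((\<lambda>s. v s - 1) has_integral 0) {0..s}"
        by (rule has_integral_is_0) (use v(2) in auto)
      then show ?thesis using has_integral_unique[OF ftc[OF that]] by (simp add: Q_def)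
    qed
    show "Q (- t) = t - integral {- t..0} v" if "0 \<le> t" for t
    proof -
      have "v integrable_on {- t..0}"
        using v(1) by (intro integrable_continuous_interval) (auto intro: continuous_on_subset)
      then have "integral {- t..0} (\<lambda>s. v s - 1) = integral {- t..0} v - t"
        using that by (subst Henstock_Kurzweil_Integration.integral_diff) auto
      moreover have "integral {- t..0} (\<lambda>s. v s - 1) = Q 0 - Q (- t)"
        using ftc[of "- t" 0] that by (intro integral_unique) auto
      ultimately show ?thesis by (simp add: Q_def)
    qed
  qed (rule Q)
qed

text \<open>The step function with value \<open>a j\<close> for \<open>- s\<close> in
  \<open>[j, j+1)\<close> is covered by overlapping tents of heights proportional to
  \<open>a j\<close>. Their sum is continuous and its integral is bounded by a multiple of the sum
  of \<open>a\<close>. A ramp starting at -1 brings the value up to 1 at 0, and the result is cut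
  off at 1.\<close>

lemma exists_continuous_majorant:
  fixes a :: "nat \<Rightarrow> real"
  assumes a: "summable a" "\<And>j. 0 < a j" "\<And>j. a j \<le> 1"
  obtains v :: "real \<Rightarrow> real" and L where "continuous_on UNIV v" "\<And>s. 0 < v s" "\<And>s. v s \<le> 1"
    "\<And>s. 0 \<le> s \<Longrightarrow> v s = 1" "\<And>s. s \<le> 0 \<Longrightarrow> a (nat \<lfloor>- s\<rfloor>) \<le> v s"
    "\<And>t. 0 \<le> t \<Longrightarrow> integral {- t..0} v \<le> L"
proof -
  \<comment> \<open>Half-width 2 makes the tent at least 1 on \<open>[-1, 1]\<close>, so the tent
    centred at \<open>- j\<close> with \<open>j = nat \<lfloor>- s\<rfloor>\<close> covers
    \<open>s\<close>.\<close>
  define \<phi> :: "real \<Rightarrow> real" where "\<phi> x = max 0 (2 - \<bar>x\<bar>)" for x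
  define G where "G s = (\<Sum>j. a j * \<phi> (s + real j))" for s
  define v where "v s = min 1 (G s + max 0 (1 + s))" for s
  \<comment> \<open>A multiple of the derivative of arctan dominates the tent, which bounds all
    integrals of tents by \<open>10 * pi\<close> without integrating a piecewise function. The 10 is
    the maximum 2 times \<open>1 + 2^2\<close>.\<close>
  have \<phi>: "0 \<le> \<phi> x" "\<phi> x \<le> 2" "\<phi> x \<le> 10 / (1 + x\<^sup>2)" for x
  proof -
    show "0 \<le> \<phi> x" "\<phi> x \<le> 2" by (auto simp: \<phi>_def)
    show "\<phi> x \<le> 10 / (1 + x\<^sup>2)"
    proof (cases "\<bar>x\<bar> \<le> 2")
      case True
      then have "x\<^sup>2 \<le> 2\<^sup>2" by (simp only: abs_le_square_iff[symmetric] abs_numeral)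
      then have "2 * (1 + x\<^sup>2) \<le> 10" by simp
      then have "2 \<le> 10 / (1 + x\<^sup>2)" by (subst pos_le_divide_eq) (auto simp: add_pos_nonneg)
      then show ?thesis using \<open>\<phi> x \<le> 2\<close> by linarith
    qed (auto simp: \<phi>_def)
  qed
  have c\<phi>: "continuous_on UNIV \<phi>" unfolding \<phi>_def by (intro continuous_intros)
  have bd: "norm (a j * \<phi> (s + real j)) \<le> 2 * a j" for j s
    using \<phi>[of "s + real j"] a(2)[of j] by (simp add: abs_mult mult.commute mult_right_mono)
  have sm: "summable (\<lambda>j. a j * \<phi> (s + real j))" for s
    by (rule summable_comparison_test'[OF summable_mult[OF a(1), of 2]]) (use bd in auto)
  have "uniform_limit UNIV (\<lambda>n s. \<Sum>j<n. a j * \<phi> (s + real j)) G sequentially"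
    unfolding G_def by (rule Weierstrass_m_test[OF _ summable_mult[OF a(1), of 2]]) (use bd in auto)
  then have cG: "continuous_on UNIV G"
    by (rule uniform_limit_theorem[rotated])
      (auto intro!: always_eventually continuous_intros continuous_on_compose2[OF c\<phi>])
  have nonneg: "0 \<le> a j * \<phi> (s + real j)" for j s
    using \<phi>(1)[of "s + real j"] a(2)[of j] by simp
  have G0: "0 \<le> G s" for s
    unfolding G_def using sm nonneg by (rule suminf_nonneg)
  have lower: "a (nat \<lfloor>- s\<rfloor>) \<le> G s" if "s \<le> 0" for s
  proof -
    let ?j = "nat \<lfloor>- s\<rfloor>"
    have "\<bar>s + real ?j\<bar> \<le> 1" using that by linarith
    then have "1 \<le> \<phi> (s + real ?j)" by (simp add: \<phi>_def)
    then have "a ?j \<le> a ?j * \<phi> (s + real ?j)" using a(2)[of ?j] by simp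
    also have "\<dots> = (\<Sum>j\<in>{?j}. a j * \<phi> (s + real j))" by simp
    also have "\<dots> \<le> G s" unfolding G_def by (rule sum_le_suminf) (use sm nonneg in auto)
    finally show ?thesis .
  qed
  have cv: "continuous_on UNIV v" unfolding v_def by (intro continuous_intros cG)
  show thesis
  proof
    show "continuous_on UNIV v" by (rule cv)
    show "0 < v s" for s
    proof (cases "s \<le> 0")
      case True
      then show ?thesis using lower[of s] a(2)[of "nat \<lfloor>- s\<rfloor>"] by (simp add: v_def)
    qed (use G0[of s] in \<open>simp add: v_def\<close>)
    show "v s \<le> 1" for s by (simp add: v_def)
    show "v s = 1" if "0 \<le> s" for s using that G0[of s] by (simp add: v_def)
    show "a (nat \<lfloor>- s\<rfloor>) \<le> v s" if "s \<le> 0" for s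
      using lower[OF that] a(3)[of "nat \<lfloor>- s\<rfloor>"] by (simp add: v_def)
    show "integral {- t..0} v \<le> 10 * pi * (suminf a + 1)" if t: "0 \<le> t" for t
    proof -
      \<comment> \<open>On \<open>[- t, 0]\<close> the tents with index at least \<open>N\<close>
        vanish, the 2 being the half-width. The series is then a finite sum, dominated by
        \<open>f\<close> with antiderivative \<open>F\<close>; the last summand of \<open>f\<close>
        takes care of the ramp.\<close>
      define N where "N = nat \<lceil>t\<rceil> + 2"
      define F where "F s = (\<Sum>j<N. a j * (10 * arctan (s + real j))) + 10 * arctan s" for s
      define f where "f s = (\<Sum>j<N. a j * (10 / (1 + (s + real j)\<^sup>2))) + 10 / (1 + s\<^sup>2)" for s :: real
      have "((\<lambda>s. \<Sum>j<N. a j * (10 * arctan (s + real j))) has_real_derivative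
          (\<Sum>j<N. a j * (10 / (1 + (s + real j)\<^sup>2)))) (at s)" for s
        by (rule DERIV_sum) (auto intro!: derivative_eq_intros simp: divide_inverse)
      moreover have "((\<lambda>s. 10 * arctan s) has_real_derivative 10 / (1 + s\<^sup>2)) (at s)" for s
        by (auto intro!: derivative_eq_intros simp: divide_inverse)
      ultimately have dF: "(F has_real_derivative f s) (at s)" for s
        unfolding F_def[abs_def] f_def by (rule DERIV_add)
      have "(f has_integral (F 0 - F (- t))) {- t..0}"
        using t dF by (intro fundamental_theorem_of_calculus)
          (auto simp: has_real_derivative_iff_has_vector_derivative intro: has_vector_derivative_at_within)
      moreover have "(v has_integral integral {- t..0} v) {- t..0}"
        using cv by (intro integrable_integral integrable_continuous_interval) (auto intro: continuous_on_subset)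
      moreover have "v s \<le> f s" if "s \<in> {- t..0}" for s
      proof -
        have "a j * \<phi> (s + real j) = 0" if "j \<notin> {..<N}" for j
        proof -
          have "2 \<le> s + real j" using that \<open>s \<in> {- t..0}\<close> unfolding N_def by simp linarith
          then show ?thesis by (simp add: \<phi>_def)
        qed
        then have "G s = (\<Sum>j<N. a j * \<phi> (s + real j))"
          unfolding G_def by (intro suminf_finite) auto
        also have "\<dots> \<le> (\<Sum>j<N. a j * (10 / (1 + (s + real j)\<^sup>2)))"
          using a(2) by (intro sum_mono mult_left_mono \<phi>) (auto simp: less_imp_le)
        finally have "G s \<le> (\<Sum>j<N. a j * (10 / (1 + (s + real j)\<^sup>2)))" .
        moreover have "max 0 (1 + s) \<le> \<phi> s" using that by (auto simp: \<phi>_def)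
        ultimately show ?thesis using \<phi>(3)[of s] unfolding v_def f_def by linarith
      qed
      ultimately have "integral {- t..0} v \<le> F 0 - F (- t)" by (meson has_integral_le)
      also have "\<dots> = (\<Sum>j<N. a j * (10 * (arctan (real j) - arctan (- t + real j)))) + 10 * (arctan 0 - arctan (- t))"
        by (simp add: F_def sum_subtractf[symmetric] algebra_simps)
      also have "\<dots> \<le> (\<Sum>j<N. a j * (10 * pi)) + 10 * pi"
      proof -
        have *: "arctan x - arctan y \<le> pi" for x y
          using arctan_ubound[of x] arctan_lbound[of y] by linarith
        show ?thesis using a(2)
          by (intro add_mono sum_mono mult_left_mono *) (auto simp: less_imp_le)
      qed
      also have "\<dots> = 10 * pi * (sum a {..<N} + 1)"
        by (simp add: distrib_left flip: sum_distrib_right)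
      also have "\<dots> \<le> 10 * pi * (suminf a + 1)"
        using sum_le_suminf[OF a(1), of "{..<N}"] a(2) by (intro mult_left_mono add_right_mono) (auto simp: less_imp_le)
      finally show ?thesis .
    qed
  qed
qed

section \<open>Sampling the generalized inverse at powers of e\<close>

lemma ennreal_inverse_antimono:
  fixes a b :: ennreal
  assumes "a \<le> b"
  shows "inverse b \<le> inverse a"
proof (cases a rule: ennreal_cases; cases b rule: ennreal_cases)
  fix x y assume "0 \<le> x" "a = ennreal x" "0 \<le> y" "b = ennreal y"
  with assms show ?thesis
    by (cases "x = 0") (auto simp: inverse_ennreal intro!: ennreal_leI le_imp_inverse_le)
qed (use assms in \<open>auto simp: top_unique\<close>)

lemma gen_inv_mono: "\<tau> \<le> \<tau>' \<Longrightarrow> gen_inv \<Phi> \<tau> \<le> gen_inv \<Phi> \<tau>'"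
  unfolding gen_inv_def by (rule Inf_superset_mono) auto

lemma ennpowr_mono: "0 \<le> \<alpha> \<Longrightarrow> x \<le> y \<Longrightarrow> ennpowr x \<alpha> \<le> ennpowr y \<alpha>"
  by (auto simp: ennpowr_def top_unique less_top intro!: ennreal_leI powr_mono2 enn2real_mono)

text \<open>The integrand is non-increasing in \<tau>, hence on \<open>(e^k, e^(k+1)]\<close> at
  least its value at the right end; the left side is the resulting lower sum. The comparison is
  pointwise with a series of indicators, so measurability is only a matter of these.\<close>

lemma gen_inv_dyadic_sum_le:
  fixes \<Phi> :: "ennreal \<Rightarrow> ennreal"
  assumes "0 \<le> \<alpha>" and J: "\<delta> \<le> exp (real J)"
  shows "(\<Sum>j. ennreal (exp (real (Suc (j + J))) - exp (real (j + J))) *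
      inverse (ennreal (exp (real (Suc (j + J)))) * ennpowr (gen_inv \<Phi> (ennreal (exp (real (Suc (j + J)))))) \<alpha>))
    \<le> (\<integral>\<^sup>+\<tau>\<in>{\<delta><..}. 1 / (ennreal \<tau> * ennpowr (gen_inv \<Phi> (ennreal \<tau>)) \<alpha>) \<partial>lebesgue)"
proof -
  define E where "E k = exp (real k)" for k
  define I where "I k = {E k<..E (Suc k)}" for k
  define P where "P \<tau> = ennpowr (gen_inv \<Phi> (ennreal \<tau>)) \<alpha>" for \<tau>
  define c where "c k = inverse (ennreal (E (Suc k)) * P (E (Suc k)))" for k
  have P: "P x \<le> P y" if "x \<le> y" for x y
    unfolding P_def using that assms(1) by (intro ennpowr_mono gen_inv_mono ennreal_leI)
  have Emono: "E i \<le> E j" if "i \<le> j" for i j using that by (simp add: E_def)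
  have pt: "(\<Sum>j. c (j + J) * indicator (I (j + J)) \<tau>) \<le> 1 / (ennreal \<tau> * P \<tau>) * indicator {\<delta><..} \<tau>" for \<tau>
  proof (cases "\<exists>j. \<tau> \<in> I (j + J)")
    case True
    then obtain j where j: "\<tau> \<in> I (j + J)" ..
    have other: "\<tau> \<notin> I (i + J)" if "i \<noteq> j" for i
    proof (cases "i < j")
      case True
      then show ?thesis using j Emono[of "Suc (i + J)" "j + J"] by (auto simp: I_def)
    next
      case False
      then show ?thesis using j that Emono[of "Suc (j + J)" "i + J"] by (auto simp: I_def)
    qed
    have "(\<Sum>j. c (j + J) * indicator (I (j + J)) \<tau>) = (\<Sum>i\<in>{j}. c (i + J) * indicator (I (i + J)) \<tau>)"
      by (rule suminf_finite) (use other in auto)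
    also have "\<dots> = c (j + J)" using j by simp
    also have "\<dots> \<le> inverse (ennreal \<tau> * P \<tau>)"
      unfolding c_def using j by (intro ennreal_inverse_antimono mult_mono ennreal_leI P) (auto simp: I_def)
    also have "\<dots> = 1 / (ennreal \<tau> * P \<tau>) * indicator {\<delta><..} \<tau>"
    proof -
      have "E J \<le> E (j + J)" by (rule Emono) simp
      moreover have "E (j + J) < \<tau>" using j by (simp add: I_def)
      moreover have "\<delta> \<le> E J" using J by (simp add: E_def)
      ultimately have "\<delta> < \<tau>" by linarith
      then show ?thesis by (simp add: divide_ennreal_def)
    qed
    finally show ?thesis .
  qed simp
  have "(\<Sum>j. ennreal (E (Suc (j + J)) - E (j + J)) * c (j + J))
      = (\<Sum>j. \<integral>\<^sup>+\<tau>. c (j + J) * indicator (I (j + J)) \<tau> \<partial>lebesgue)"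
    using Emono by (intro suminf_cong, subst nn_integral_cmult_indicator) (auto simp: I_def mult.commute)
  also have "\<dots> = (\<integral>\<^sup>+\<tau>. (\<Sum>j. c (j + J) * indicator (I (j + J)) \<tau>) \<partial>lebesgue)"
    by (intro nn_integral_suminf[symmetric] borel_measurable_times_ennreal borel_measurable_indicator)
      (auto simp: I_def)
  also have "\<dots> \<le> (\<integral>\<^sup>+\<tau>\<in>{\<delta><..}. 1 / (ennreal \<tau> * P \<tau>) \<partial>lebesgue)"
    by (intro nn_integral_mono pt)
  finally show ?thesis unfolding c_def P_def E_def .
qed

text \<open>The choice is \<open>1 / a k ^ (n - 1) = T k / 2\<close> for large \<open>k\<close>, up
  to a cap, where \<open>T k\<close> is the generalized inverse at \<open>e^k\<close>. Half of
  \<open>T k\<close> lies strictly below the infimum that defines \<open>T k\<close>, so \<Phi> is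
  still less than \<open>e^k\<close> there. Summability of \<open>a\<close> is the finiteness of the
  lower sum.\<close>

lemma exists_dilatation_sequence:
  fixes \<Phi> :: "ennreal \<Rightarrow> ennreal"
  assumes n: "2 \<le> n" and mono: "mono \<Phi>"
    and fin: "(\<integral>\<^sup>+\<tau>\<in>{\<delta><..}. 1 / (ennreal \<tau> * ennpowr (gen_inv \<Phi> (ennreal \<tau>)) (1 / (real n - 1))) \<partial>lebesgue) \<noteq> \<infinity>"
  obtains a :: "nat \<Rightarrow> real" and C where "summable a" "\<And>j. 0 < a j" "\<And>j. a j \<le> 1"
    "0 \<le> C" "\<And>j. \<Phi> (ennreal (1 / a j ^ (n - 1))) \<le> ennreal (C * exp (real j))"
proof -
  define \<alpha> where "\<alpha> = 1 / (real n - 1)"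
  have \<alpha>: "0 < \<alpha>" "\<alpha> * real (n - 1) = 1" using n by (auto simp: \<alpha>_def of_nat_diff)
  define E where "E k = exp (real k)" for k
  define T where "T k = gen_inv \<Phi> (ennreal (E k))" for k
  define summand where "summand k = ennreal (E (Suc k) - E k) * inverse (ennreal (E (Suc k)) * ennpowr (T (Suc k)) \<alpha>)" for k
  \<comment> \<open>The length of \<open>(e^k, e^(k+1)]\<close> divided by its right end is
    \<open>1 - exp (- 1)\<close> for every \<open>k\<close>, so \<open>summand k\<close> is in
    essence \<epsilon> times \<open>T (Suc k)\<close> to the power
    \<open>- \<alpha>\<close>.\<close>
  define \<epsilon> :: real where "\<epsilon> = 1 - exp (- 1)"
  have \<epsilon>: "0 < \<epsilon>" by (simp add: \<epsilon>_def)
  have Ediff: "E (Suc k) - E k = E (Suc k) * \<epsilon>" for k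
    by (simp add: E_def \<epsilon>_def algebra_simps flip: exp_add)
  have E0: "0 < E k" for k by (simp add: E_def)
  have real_le_E: "x \<le> E k" if "x \<le> real k" for x k
    using that exp_ge_add_one_self[of "real k"] unfolding E_def by linarith
  have sumfin: "(\<Sum>j. summand (j + J)) \<noteq> top" if "\<delta> \<le> real J" for J
  proof -
    have "(\<Sum>j. summand (j + J)) \<le> (\<integral>\<^sup>+\<tau>\<in>{\<delta><..}. 1 / (ennreal \<tau> * ennpowr (gen_inv \<Phi> (ennreal \<tau>)) \<alpha>) \<partial>lebesgue)"
      unfolding summand_def T_def E_def
      by (rule gen_inv_dyadic_sum_le) (use \<alpha>(1) real_le_E[OF that] in \<open>auto simp: E_def\<close>)
    then show ?thesis using fin[folded \<alpha>_def] neq_top_trans unfolding infinity_ennreal_def by blast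
  qed
  have summand_ge: "ennreal (\<epsilon> * t powr (- \<alpha>)) \<le> summand k" if "T (Suc k) \<le> ennreal t" "0 < t" for t k
  proof -
    have "ennpowr (T (Suc k)) \<alpha> \<le> ennpowr (ennreal t) \<alpha>"
      using that \<alpha>(1) by (intro ennpowr_mono) auto
    then have "ennreal (E (Suc k)) * ennpowr (T (Suc k)) \<alpha> \<le> ennreal (E (Suc k) * t powr \<alpha>)"
      using that(2) E0[of "Suc k"] by (simp add: ennpowr_def ennreal_mult mult_left_mono)
    then have "inverse (ennreal (E (Suc k) * t powr \<alpha>)) \<le> inverse (ennreal (E (Suc k)) * ennpowr (T (Suc k)) \<alpha>)"
      by (rule ennreal_inverse_antimono)
    moreover have "inverse (ennreal (E (Suc k) * t powr \<alpha>)) = ennreal (inverse (E (Suc k) * t powr \<alpha>))"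
      using that(2) E0[of "Suc k"] by (intro inverse_ennreal) simp
    ultimately have "ennreal (inverse (E (Suc k) * t powr \<alpha>)) \<le> inverse (ennreal (E (Suc k)) * ennpowr (T (Suc k)) \<alpha>)"
      by (simp only:)
    then have "ennreal (E (Suc k) - E k) * ennreal (inverse (E (Suc k) * t powr \<alpha>)) \<le> summand k"
      unfolding summand_def by (rule mult_left_mono) simp
    moreover have "ennreal (E (Suc k) - E k) * ennreal (inverse (E (Suc k) * t powr \<alpha>)) = ennreal (\<epsilon> * t powr (- \<alpha>))"
      unfolding Ediff using E0[of "Suc k"] \<epsilon> by (simp add: powr_minus flip: ennreal_mult)
    ultimately show ?thesis by simp
  qed
  \<comment> \<open>An infinite value at a finite point would bound all \<open>T k\<close> at once
    and keep the summands above a positive constant, contradicting convergence. Passing to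
    \<open>max 1 t\<close> only secures positivity.\<close>
  have \<Phi>fin: "\<Phi> (ennreal t) \<noteq> top" for t
  proof
    assume top: "\<Phi> (ennreal t) = top"
    define t' where "t' = max 1 t"
    have "\<Phi> (ennreal t) \<le> \<Phi> (ennreal t')" by (intro monoD[OF mono] ennreal_leI) (simp add: t'_def)
    then have top': "\<Phi> (ennreal t') = top" using top by (simp add: top_unique)
    have "T k \<le> ennreal t'" for k
      unfolding T_def gen_inv_def by (rule Inf_lower) (simp add: top')
    then have ge: "ennreal (\<epsilon> * t' powr (- \<alpha>)) \<le> summand k" for k by (intro summand_ge) (auto simp: t'_def)
    obtain J :: nat where J: "\<delta> \<le> real J" using real_arch_simple by blast
    have "(\<Sum>j::nat. ennreal (\<epsilon> * t' powr (- \<alpha>))) \<le> (\<Sum>j. summand (j + J))"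
      by (intro suminf_le ge) auto
    then have "(\<Sum>j::nat. ennreal (\<epsilon> * t' powr (- \<alpha>))) \<noteq> top"
      using sumfin[OF J] by (auto simp: top_unique)
    then have "summable (\<lambda>j::nat. \<epsilon> * t' powr (- \<alpha>))"
      using \<epsilon> by (intro summable_suminf_not_top) auto
    then show False using \<epsilon> by (simp add: summable_const_iff t'_def)
  qed
  \<comment> \<open>Three demands meet here: the lower sum from \<open>J0\<close> on is controlled
    by the integral, \<open>E k\<close> is at least 2, and \<open>E k\<close> exceeds
    \<open>\<Phi> 2\<close>. The last forces \<open>T k\<close> to be at least 2, so that
    \<open>\<beta> k\<close> below is at least 1. The shift in \<open>N = Suc J0\<close> matches the
    occurrence of \<open>T (Suc k)\<close> in \<open>summand k\<close>.\<close>
  obtain J0 :: nat where J0: "max \<delta> (max 2 (enn2real (\<Phi> 2) + 1)) \<le> real J0" using real_arch_simple by blast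
  define N where "N = Suc J0"
  have big: "2 \<le> E k" "enn2real (\<Phi> 2) < E k" if "N \<le> k" for k
    using that J0 real_le_E[of 2 k] real_le_E[of "enn2real (\<Phi> 2) + 1" k] by (auto simp: N_def)
  have T2: "2 \<le> T k" if "N \<le> k" for k
    unfolding T_def gen_inv_def
  proof (rule Inf_greatest, rule ccontr)
    fix t assume t: "t \<in> {t. ennreal (E k) \<le> \<Phi> t}" "\<not> 2 \<le> t"
    then have "\<Phi> t \<le> \<Phi> 2" by (intro monoD[OF mono]) simp
    then have "ennreal (E k) \<le> \<Phi> 2" using t(1) by simp
    moreover have "\<Phi> 2 = ennreal (enn2real (\<Phi> 2))"
      using \<Phi>fin[of 2] by (simp add: less_top)
    ultimately have "ennreal (E k) \<le> ennreal (enn2real (\<Phi> 2))" by simp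
    then show False using big(2)[OF that] by (simp add: ennreal_le_iff)
  qed
  \<comment> \<open>The cap by \<open>E k\<close> is for the indices where \<open>T k\<close> is
    infinite, that is, where \<Phi> stays below \<open>e^k\<close> on the finite half-line. It costs
    only a geometric series of ratio \<open>exp (- \<alpha>)\<close>.\<close>
  define \<beta> where "\<beta> k = enn2real (min (T k) (ennreal (E k))) / 2" for k
  have \<beta>: "1 \<le> \<beta> k" "ennreal (\<beta> k) < T k" if "N \<le> k" for k
  proof -
    define m where "m = min (T k) (ennreal (E k))"
    have m2: "2 \<le> m" using T2[OF that] big(1)[OF that] by (simp add: m_def)
    have "m \<le> ennreal (E k)" by (simp add: m_def)
    then obtain r where r: "m = ennreal r" "0 \<le> r" by (cases m) (auto simp: top_unique)
    have r2: "2 \<le> r" using m2 r by (simp add: ennreal_numeral[symmetric] ennreal_le_iff del: ennreal_numeral)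
    have br: "\<beta> k = r / 2" using r by (simp add: \<beta>_def m_def[symmetric])
    then show "1 \<le> \<beta> k" using r2 by simp
    have "ennreal (\<beta> k) < m" using br r r2 by (simp add: ennreal_less_iff)
    then show "ennreal (\<beta> k) < T k" by (simp add: m_def)
  qed
  define a where "a k = (if k < N then 1 else \<beta> k powr (- \<alpha>))" for k
  \<comment> \<open>The uncapped part of the sequence. Its value 0 at
    \<open>T k = \<infinity>\<close> agrees with \<open>1 / \<infinity> = 0\<close> in
    \<open>summand\<close>.\<close>
  define d where "d k = (if T k = top then 0 else enn2real (T k) powr (- \<alpha>))" for k
  have sd: "summable (\<lambda>j. d (j + N))"
  proof -
    have "ennreal (\<epsilon> * d (j + N)) \<le> summand (j + J0)" for j
    proof (cases "T (j + N) = top")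
      case False
      then obtain r where r: "T (j + N) = ennreal r" "0 \<le> r" by (cases "T (j + N)") auto
      have "2 \<le> ennreal r" using T2[of "j + N"] r by simp
      then have "r > 0" by (cases "r = 0") (use r in auto)
      then show ?thesis using r summand_ge[of "j + J0" r] by (simp add: d_def N_def)
    qed (simp add: d_def)
    then have "(\<Sum>j. ennreal (\<epsilon> * d (j + N))) \<le> (\<Sum>j. summand (j + J0))" by (intro suminf_le) auto
    then have "(\<Sum>j. ennreal (\<epsilon> * d (j + N))) \<noteq> top"
      using sumfin[of J0] J0 by (auto simp: top_unique)
    then have "summable (\<lambda>j. \<epsilon> * d (j + N))"
      using \<epsilon> by (intro summable_suminf_not_top) (auto simp: d_def)
    then show ?thesis using \<epsilon> by simp
  qed
  have half: "(x / 2) powr (- \<alpha>) = 2 powr \<alpha> * x powr (- \<alpha>)" for x :: real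
  proof -
    have "(x / 2) powr (- \<alpha>) = x powr (- \<alpha>) / 2 powr (- \<alpha>)"
      by (rule powr_divide)
    also have "2 powr (- \<alpha>) = 1 / 2 powr \<alpha>" by (rule powr_minus_divide)
    finally show ?thesis by simp
  qed
  have a_le: "\<beta> k powr (- \<alpha>) \<le> 2 powr \<alpha> * (d k + exp (- \<alpha>) ^ k)" if "N \<le> k" for k
  proof (cases "T k \<le> ennreal (E k)")
    case True
    then have nt: "T k \<noteq> top" by (auto simp: top_unique)
    have "\<beta> k = enn2real (T k) / 2" using True by (simp add: \<beta>_def min_def)
    then have "\<beta> k powr (- \<alpha>) = 2 powr \<alpha> * d k"
      using nt half[of "enn2real (T k)"] by (simp only: d_def if_False)
    then show ?thesis by (simp add: algebra_simps)
  next
    case False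
    then have "\<beta> k = E k / 2" using E0[of k] by (simp add: \<beta>_def min_def)
    then have "\<beta> k powr (- \<alpha>) = 2 powr \<alpha> * E k powr (- \<alpha>)"
      using half[of "E k"] by (simp only:)
    also have "E k powr (- \<alpha>) = exp (real k * - \<alpha>)"
      by (simp add: E_def powr_def)
    also have "\<dots> = exp (- \<alpha>) ^ k" by (rule exp_of_nat_mult)
    finally show ?thesis by (simp add: algebra_simps d_def)
  qed
  show thesis
  proof
    have "summable (\<lambda>j. 2 powr \<alpha> * (d (j + N) + exp (- \<alpha>) ^ (j + N)))"
      using \<alpha>(1) sd by (intro summable_mult summable_add summable_ignore_initial_segment summable_geometric) auto
    then have "summable (\<lambda>j. a (j + N))"
      by (rule summable_comparison_test'[where N=0]) (use a_le in \<open>auto simp: a_def\<close>)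
    then show "summable a" by (simp only: summable_iff_shift)
    show "0 < a j" for j
    proof (cases "j < N")
      case False
      then have "1 \<le> \<beta> j" by (intro \<beta>) simp
      then show ?thesis using False by (simp add: a_def)
    qed (simp add: a_def)
    show "a j \<le> 1" for j
    proof (cases "j < N")
      case False
      then have "1 \<le> \<beta> j" by (intro \<beta>) simp
      then have "1 \<le> \<beta> j powr \<alpha>" using \<alpha>(1) by (intro ge_one_powr_ge_zero) auto
      then show ?thesis using False by (simp add: a_def powr_minus inverse_le_1_iff)
    qed (simp add: a_def)
    \<comment> \<open>The constant absorbs the indices below \<open>N\<close>, where
      \<open>a j = 1\<close> and the left side of the bound is \<open>\<Phi> 1\<close>; from
      \<open>N\<close> on the constant 1 would do.\<close>
    show "0 \<le> max 1 (enn2real (\<Phi> 1))" by simp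
    show "\<Phi> (ennreal (1 / a j ^ (n - 1))) \<le> ennreal (max 1 (enn2real (\<Phi> 1)) * exp (real j))" for j
    proof (cases "j < N")
      case True
      have "\<Phi> 1 = ennreal (enn2real (\<Phi> 1))" using \<Phi>fin[of 1] by (simp add: less_top)
      also have "\<dots> \<le> ennreal (max 1 (enn2real (\<Phi> 1)) * exp (real j))"
      proof (rule ennreal_leI)
        have "enn2real (\<Phi> 1) * 1 \<le> max 1 (enn2real (\<Phi> 1)) * exp (real j)" by (intro mult_mono) auto
        then show "enn2real (\<Phi> 1) \<le> max 1 (enn2real (\<Phi> 1)) * exp (real j)" by simp
      qed
      finally show ?thesis using True by (simp add: a_def)
    next
      case False
      then have b: "1 \<le> \<beta> j" "ennreal (\<beta> j) < T j" using \<beta>[of j] by auto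
      have "a j ^ (n - 1) = (\<beta> j powr (- \<alpha>)) powr real (n - 1)"
        using False b by (simp add: a_def powr_realpow)
      also have "\<dots> = \<beta> j powr (- (\<alpha> * real (n - 1)))" by (simp add: powr_powr)
      also have "\<dots> = 1 / \<beta> j" unfolding \<alpha>(2) using b by (simp add: powr_minus_divide)
      finally have "1 / a j ^ (n - 1) = \<beta> j" by simp
      moreover have "\<not> ennreal (E j) \<le> \<Phi> (ennreal (\<beta> j))"
        using b(2) Inf_lower[of "ennreal (\<beta> j)" "{t. ennreal (E j) \<le> \<Phi> t}"] by (auto simp: T_def gen_inv_def)
      ultimately have "\<Phi> (ennreal (1 / a j ^ (n - 1))) \<le> ennreal (E j)" by simp
      also have "\<dots> \<le> ennreal (max 1 (enn2real (\<Phi> 1)) * exp (real j))"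
      proof (rule ennreal_leI)
        have "1 * E j \<le> max 1 (enn2real (\<Phi> 1)) * exp (real j)" unfolding E_def by (intro mult_mono) auto
        then show "E j \<le> max 1 (enn2real (\<Phi> 1)) * exp (real j)" by simp
      qed
      finally show ?thesis .
    qed
  qed
qed

text \<open>The majorant at \<open>s\<close> is at least \<open>a j\<close> with
  \<open>j = nat \<lfloor>- s\<rfloor>\<close>, so its dilatation is at most that of
  \<open>a j\<close>, and \<open>j \<le> max 0 (- s)\<close>. For \<open>s = log r\<close> the bound
  on \<Phi> reads \<open>C * max 1 (1 / r)\<close>.\<close>

lemma exists_dilatation_profile:
  fixes \<Phi> :: "ennreal \<Rightarrow> ennreal"
  assumes n: "2 \<le> n" and mono: "mono \<Phi>"
    and fin: "(\<integral>\<^sup>+\<tau>\<in>{\<delta><..}. 1 / (ennreal \<tau> * ennpowr (gen_inv \<Phi> (ennreal \<tau>)) (1 / (real n - 1))) \<partial>lebesgue) \<noteq> \<infinity>"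
  obtains v :: "real \<Rightarrow> real" and L C where "continuous_on UNIV v" "\<And>s. 0 < v s" "\<And>s. v s \<le> 1"
    "\<And>s. 0 \<le> s \<Longrightarrow> v s = 1" "\<And>t. 0 \<le> t \<Longrightarrow> integral {- t..0} v \<le> L" "0 \<le> C"
    "\<And>s. \<Phi> (ennreal (1 / v s ^ (n - 1))) \<le> ennreal (C * exp (max 0 (- s)))"
proof (rule exists_dilatation_sequence[OF n mono fin])
  fix a :: "nat \<Rightarrow> real" and C
  assume a: "summable a" "\<And>j. 0 < a j" "\<And>j. a j \<le> 1" "0 \<le> C"
    "\<And>j. \<Phi> (ennreal (1 / a j ^ (n - 1))) \<le> ennreal (C * exp (real j))"
  show thesis
  proof (rule exists_continuous_majorant[OF a(1-3)])
    fix v :: "real \<Rightarrow> real" and L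
    assume v: "continuous_on UNIV v" "\<And>s. 0 < v s" "\<And>s. v s \<le> 1"
      "\<And>s. 0 \<le> s \<Longrightarrow> v s = 1" "\<And>s. s \<le> 0 \<Longrightarrow> a (nat \<lfloor>- s\<rfloor>) \<le> v s"
      "\<And>t. 0 \<le> t \<Longrightarrow> integral {- t..0} v \<le> L"
    have "\<Phi> (ennreal (1 / v s ^ (n - 1))) \<le> ennreal (C * exp (max 0 (- s)))" for s
    proof -
      let ?j = "nat \<lfloor>- s\<rfloor>"
      have "a ?j \<le> v s"
        using v(5)[of s] v(4)[of s] a(3)[of ?j] by (cases "s \<le> 0") auto
      then have "1 / v s ^ (n - 1) \<le> 1 / a ?j ^ (n - 1)"
        using a(2)[of ?j] v(2)[of s] by (intro divide_left_mono power_mono mult_pos_pos zero_less_power) auto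
      then have "\<Phi> (ennreal (1 / v s ^ (n - 1))) \<le> \<Phi> (ennreal (1 / a ?j ^ (n - 1)))"
        by (intro monoD[OF mono] ennreal_leI)
      also have "\<dots> \<le> ennreal (C * exp (real ?j))" by (rule a(5))
      also have "\<dots> \<le> ennreal (C * exp (max 0 (- s)))"
      proof (intro ennreal_leI mult_left_mono a(4))
        have "real ?j \<le> max 0 (- s)" by linarith
        then show "exp (real ?j) \<le> exp (max 0 (- s))" by simp
      qed
      finally show ?thesis .
    qed
    then show thesis by (intro that[OF v(1-4) v(6) a(4)])
  qed
qed

section \<open>Radial stretchings\<close>

text \<open>An orthogonal map taking a coordinate axis to \<open>e\<close> conjugates the map to a
  diagonal one. Derivatives of radial maps have this form, with \<open>e\<close> the radial
  direction.\<close>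

lemma det_rank_one_update:
  fixes e :: "real^'n"
  assumes e: "norm e = 1"
  shows "det (matrix (\<lambda>v. a *\<^sub>R (v + (b * (e \<bullet> v)) *\<^sub>R e))) = a ^ CARD('n) * (1 + b)"
proof -
  define k :: 'n where "k = undefined"
  define A where "A = (\<lambda>v. a *\<^sub>R (v + (b * (e \<bullet> v)) *\<^sub>R e))"
  define B where "B = (\<lambda>v::real^'n. a *\<^sub>R (v + (b * v $ k) *\<^sub>R axis k 1))"
  obtain f :: "real^'n \<Rightarrow> real^'n" where f: "orthogonal_transformation f" "f (axis k 1) = e"
    using orthogonal_transformation_exists_1[of "axis k 1" e] e by auto
  have lf: "linear f" using f(1) orthogonal_transformation_linear by blast
  have lA: "linear A" unfolding A_def
    by (intro linearI) (auto simp: algebra_simps inner_add_right)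
  have lB: "linear B" unfolding B_def
    by (intro linearI) (auto simp: algebra_simps)
  have "A \<circ> f = f \<circ> B"
  proof
    fix v
    have "e \<bullet> f v = v $ k"
    proof -
      have "f (axis k 1) \<bullet> f v = axis k 1 \<bullet> v"
        using f(1) unfolding orthogonal_transformation_def by blast
      then show ?thesis by (simp add: f(2) inner_axis')
    qed
    then show "(A \<circ> f) v = (f \<circ> B) v"
      using lf f(2) by (simp add: A_def B_def linear_add linear_scale)
  qed
  then have "matrix A ** matrix f = matrix f ** matrix B"
    using lA lB lf by (metis matrix_compose)
  then have "det (matrix A) * det (matrix f) = det (matrix f) * det (matrix B)"
    by (metis det_mul)
  moreover have "det (matrix f) \<noteq> 0"
    using f(1) by (metis abs_zero orthogonal_transformation_det zero_neq_one)
  ultimately have "det (matrix A) = det (matrix B)" by simp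
  also have "\<dots> = (\<Prod>i\<in>UNIV. matrix B $ i $ i)"
    by (rule det_diagonal) (auto simp: matrix_def B_def axis_def)
  also have "\<dots> = (\<Prod>i\<in>UNIV. a * (if i = k then 1 + b else 1))"
    by (intro prod.cong) (auto simp: matrix_def B_def axis_def)
  also have "\<dots> = a ^ CARD('n) * (1 + b)"
    by (simp add: prod.distrib)
  finally show ?thesis unfolding A_def .
qed

text \<open>Up to the factor \<open>a\<close>, components orthogonal to \<open>e\<close> are kept
  and the component along \<open>e\<close> shrinks by \<open>w \<le> 1\<close>, so the least stretch
  is attained at \<open>e\<close>.\<close>

lemma min_stretch_rank_one:
  fixes e :: "real^'n"
  assumes e: "norm e = 1" and a: "0 < a" and w: "0 < w" "w \<le> 1"
  shows "min_stretch (\<lambda>v. a *\<^sub>R (v + ((w - 1) * (e \<bullet> v)) *\<^sub>R e)) = a * w"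
proof -
  let ?A = "\<lambda>v. a *\<^sub>R (v + ((w - 1) * (e \<bullet> v)) *\<^sub>R e)"
  have ee: "e \<bullet> e = 1" using e by (simp add: norm_eq_1)
  have lower: "a * w * norm v \<le> norm (?A v)" for v
  proof -
    let ?u = "v + ((w - 1) * (e \<bullet> v)) *\<^sub>R e"
    have "\<bar>e \<bullet> v\<bar> \<le> norm v" using Cauchy_Schwarz_ineq2[of e v] e by simp
    then have "(e \<bullet> v)\<^sup>2 \<le> (norm v)\<^sup>2" by (metis abs_le_square_iff abs_norm_cancel)
    moreover have "w\<^sup>2 \<le> 1" using w by (simp add: power_le_one)
    ultimately have "(1 - w\<^sup>2) * (e \<bullet> v)\<^sup>2 \<le> (1 - w\<^sup>2) * (norm v)\<^sup>2"
      by (intro mult_left_mono) auto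
    moreover have "(norm ?u)\<^sup>2 = (norm v)\<^sup>2 - (1 - w\<^sup>2) * (e \<bullet> v)\<^sup>2"
      unfolding power2_norm_eq_inner
      by (simp add: inner_add_left inner_add_right ee inner_commute[of v e] power2_eq_square algebra_simps)
    ultimately have "(w * norm v)\<^sup>2 \<le> (norm ?u)\<^sup>2"
      by (simp add: power_mult_distrib algebra_simps)
    then have "w * norm v \<le> norm ?u" by (rule power2_le_imp_le) simp
    then show ?thesis using a by (simp add: mult.assoc)
  qed
  have "?A e = (a * w) *\<^sub>R e" by (simp add: ee algebra_simps)
  then have att: "norm (?A e) / norm e = a * w" using a w e by simp
  show ?thesis unfolding min_stretch_def
  proof (rule antisym)
    show "(INF v\<in>{v. v \<noteq> 0}. norm (?A v) / norm v) \<le> a * w"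
    proof (rule cINF_lower2)
      show "bdd_below ((\<lambda>v. norm (?A v) / norm v) ` {v. v \<noteq> 0})"
        by (rule bdd_belowI[of _ 0]) auto
      show "e \<in> {v. v \<noteq> 0}" using e by auto
      show "norm (?A e) / norm e \<le> a * w" using att by simp
    qed
    show "a * w \<le> (INF v\<in>{v. v \<noteq> 0}. norm (?A v) / norm v)"
      using e lower by (intro cINF_greatest) (auto simp: pos_le_divide_eq)
  qed
qed

lemma K_I_rank_one:
  fixes e :: "real^'n"
  assumes e: "norm e = 1" and a: "0 < a" and w: "0 < w" "w \<le> 1"
    and der: "(g has_derivative (\<lambda>v. a *\<^sub>R (v + ((w - 1) * (e \<bullet> v)) *\<^sub>R e))) (at x)"
  shows "K_I g x = ennreal (1 / w ^ (CARD('n) - 1))"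
proof -
  have "frechet_derivative g (at x) = (\<lambda>v. a *\<^sub>R (v + ((w - 1) * (e \<bullet> v)) *\<^sub>R e))"
    using frechet_derivative_at[OF der] by simp
  moreover have "g differentiable at x" using der by (auto simp: differentiable_def)
  moreover have "a ^ CARD('n) * w / (a * w) ^ CARD('n) = 1 / w ^ (CARD('n) - 1)"
    using a w zero_less_card_finite[where 'a='n]
    by (cases "CARD('n)") (auto simp: power_mult_distrib)
  ultimately show ?thesis
    unfolding K_I_def using a w
    by (simp add: Let_def det_rank_one_update[OF e] min_stretch_rank_one[OF e a w] abs_mult)
qed

lemma K_I_cong_open:
  fixes g h :: "real^'n \<Rightarrow> real^'n"
  assumes "open U" "x \<in> U" "\<And>y. y \<in> U \<Longrightarrow> g y = h y"
  shows "K_I g x = K_I h x"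
proof -
  have "(g has_derivative A) (at x) \<longleftrightarrow> (h has_derivative A) (at x)" for A
    using assms has_derivative_transform_within_open[of g A x UNIV U h]
      has_derivative_transform_within_open[of h A x UNIV U g] by auto
  then show ?thesis
    unfolding K_I_def frechet_derivative_def differentiable_def by simp
qed

text \<open>A single condition from which both local requirements of the class follow at a finite
  point: a continuous derivative gives the Sobolev property on small balls, a continuous real-valued
  dilatation gives local integrability. It depends only on the germ of the map, which makes gluing
  possible.\<close>

definition regular_at :: "(real^'n \<Rightarrow> real^'n) \<Rightarrow> real^'n \<Rightarrow> bool" where
  "regular_at g x \<longleftrightarrow> (\<exists>U g' \<kappa>. open U \<and> x \<in> U \<and>
     (\<forall>y\<in>U. (g has_derivative g' y) (at y) \<and> K_I g y = ennreal (\<kappa> y)) \<and>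
     continuous_on U \<kappa> \<and> (\<forall>b. continuous_on U (\<lambda>y. g' y b)))"

lemma regular_at_cong_open:
  assumes "open V" "x \<in> V" "\<And>y. y \<in> V \<Longrightarrow> g y = h y" "regular_at g x"
  shows "regular_at h x"
proof -
  obtain U g' \<kappa> where U: "open U" "x \<in> U"
     "\<And>y. y\<in>U \<Longrightarrow> (g has_derivative g' y) (at y) \<and> K_I g y = ennreal (\<kappa> y)"
     "continuous_on U \<kappa>" "\<And>b. continuous_on U (\<lambda>y. g' y b)"
    using assms(4) unfolding regular_at_def by blast
  have "(h has_derivative g' y) (at y) \<and> K_I h y = ennreal (\<kappa> y)" if "y \<in> U \<inter> V" for y
  proof
    show "(h has_derivative g' y) (at y)"
      using that U(3)[of y] assms has_derivative_transform_within_open[of g "g' y" y UNIV V h] by auto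
    show "K_I h y = ennreal (\<kappa> y)"
      using that U(3)[of y] K_I_cong_open[of V y g h] assms by auto
  qed
  then show ?thesis unfolding regular_at_def
    using U assms(1,2)
    by (intro exI[of _ "U \<inter> V"] exI[of _ g'] exI[of _ \<kappa>]) (auto intro: continuous_on_subset)
qed

text \<open>The modulus is \<open>exp (S r) * r\<close>, so \<open>S\<close> is the logarithm of its
  ratio to the identity: \<open>S = 0\<close> gives the identity and constant \<open>S\<close> a
  similarity. The logarithmic derivative \<open>w\<close> of the modulus enters as
  \<open>S' = (w - 1) / r\<close>. The centre is always fixed.\<close>

definition radial_map :: "'a::euclidean_space \<Rightarrow> (real \<Rightarrow> real) \<Rightarrow> 'a \<Rightarrow> 'a" where
  "radial_map c S x = c + exp (S (norm (x - c))) *\<^sub>R (x - c)"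

lemma radial_map_has_derivative:
  assumes "x \<noteq> c"
    and "\<And>r. 0 < r \<Longrightarrow> (S has_real_derivative (w r - 1) / r) (at r)"
  shows "(radial_map c S has_derivative (\<lambda>v. exp (S (norm (x - c))) *\<^sub>R
      (v + ((w (norm (x - c)) - 1) * (sgn (x - c) \<bullet> v)) *\<^sub>R sgn (x - c)))) (at x)"
proof -
  define r where "r = norm (x - c)"
  have r: "r > 0" using assms(1) by (simp add: r_def)
  have n: "((\<lambda>x. norm (x - c)) has_derivative (\<lambda>v. sgn (x - c) \<bullet> v)) (at x)"
  proof -
    have "((\<lambda>x. x - c) has_derivative (\<lambda>v. v)) (at x)" by (auto intro!: derivative_eq_intros)
    from has_derivative_compose[OF this has_derivative_norm] assms(1)
    have "((\<lambda>x. norm (x - c)) has_derivative (\<lambda>v. v \<bullet> sgn (x - c))) (at x)" by simp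
    then show ?thesis by (simp add: inner_commute)
  qed
  have S: "(S has_derivative (*) ((w r - 1) / r)) (at (norm (x - c)))"
    using assms(2)[OF r] by (simp add: r_def has_field_derivative_def)
  have "((\<lambda>x. S (norm (x - c))) has_derivative (\<lambda>v. ((w r - 1) / r) * (sgn (x - c) \<bullet> v))) (at x)"
    using has_derivative_compose[OF n S] .
  from has_derivative_exp[OF this]
  have "((\<lambda>x. exp (S (norm (x - c)))) has_derivative
      (\<lambda>v. exp (S r) * ((sgn (x - c) \<bullet> v) * ((w r - 1) / r)))) (at x)"
    by (simp only: r_def mult.commute)
  moreover have "((\<lambda>x. x - c) has_derivative (\<lambda>v. v)) (at x)"
    by (auto intro!: derivative_eq_intros)
  ultimately have "((\<lambda>x. exp (S (norm (x - c))) *\<^sub>R (x - c)) has_derivative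
      (\<lambda>v. exp (S r) *\<^sub>R v + (exp (S r) * ((sgn (x - c) \<bullet> v) * ((w r - 1) / r))) *\<^sub>R (x - c))) (at x)"
    unfolding r_def by (rule has_derivative_scaleR)
  then have "((\<lambda>x. c + exp (S (norm (x - c))) *\<^sub>R (x - c)) has_derivative
      (\<lambda>v. exp (S r) *\<^sub>R v + (exp (S r) * ((sgn (x - c) \<bullet> v) * ((w r - 1) / r))) *\<^sub>R (x - c))) (at x)"
    using has_derivative_add[OF has_derivative_const[of c "at x"]] by fastforce
  moreover have "(exp (S r) * ((sgn (x - c) \<bullet> v) * ((w r - 1) / r))) *\<^sub>R (x - c)
      = exp (S r) *\<^sub>R (((w r - 1) * (sgn (x - c) \<bullet> v)) *\<^sub>R sgn (x - c))" for v
    by (simp add: sgn_div_norm[of "x - c"] divide_inverse mult_ac flip: r_def)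
  ultimately show ?thesis
    unfolding radial_map_def[abs_def] r_def[symmetric] by (simp add: scaleR_add_right)
qed

lemma radial_map_K_I:
  fixes c :: "real^'n"
  assumes "x \<noteq> c"
    and S: "\<And>r. 0 < r \<Longrightarrow> (S has_real_derivative (w r - 1) / r) (at r)"
    and w: "\<And>r. 0 < r \<Longrightarrow> 0 < w r" "\<And>r. 0 < r \<Longrightarrow> w r \<le> 1"
  shows "K_I (radial_map c S) x = ennreal (1 / w (norm (x - c)) ^ (CARD('n) - 1))"
  using assms(1) w[of "norm (x - c)"]
  by (intro K_I_rank_one[OF _ _ _ _ radial_map_has_derivative[OF assms(1) S]]) (auto simp: norm_sgn)

lemma radial_map_regular:
  fixes c :: "real^'n"
  assumes "x \<noteq> c"
    and S: "\<And>r. 0 < r \<Longrightarrow> (S has_real_derivative (w r - 1) / r) (at r)"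
    and w: "\<And>r. 0 < r \<Longrightarrow> 0 < w r" "\<And>r. 0 < r \<Longrightarrow> w r \<le> 1"
    and cont: "continuous_on {0<..} w"
  shows "regular_at (radial_map c S) x"
proof -
  have "continuous_on {0<..} S"
    by (intro DERIV_continuous_on[of _ _ "\<lambda>r. (w r - 1) / r"])
      (use S in \<open>auto intro: has_field_derivative_at_within\<close>)
  then have cS: "continuous_on (- {c}) (\<lambda>y. S (norm (y - c)))"
    by (rule continuous_on_compose2) (auto intro!: continuous_intros)
  have cw: "continuous_on (- {c}) (\<lambda>y. w (norm (y - c)))"
    by (rule continuous_on_compose2[OF cont]) (auto intro!: continuous_intros)
  have csgn: "continuous_on (- {c}) (\<lambda>y. sgn (y - c))"
    unfolding sgn_div_norm by (intro continuous_intros) auto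
  have "w (norm (y - c)) > 0" if "y \<noteq> c" for y using w[of "norm (y - c)"] that by simp
  then have "w (norm (y - c)) ^ (CARD('n) - 1) \<noteq> 0" if "y \<noteq> c" for y
    using that by (metis less_irrefl power_not_zero)
  then show ?thesis
    unfolding regular_at_def
    using assms(1) radial_map_has_derivative[OF _ S] radial_map_K_I[OF _ S w] cS cw csgn
    by (intro exI[of _ "- {c}"]
      exI[of _ "\<lambda>y v. exp (S (norm (y - c))) *\<^sub>R
      (v + ((w (norm (y - c)) - 1) * (sgn (y - c) \<bullet> v)) *\<^sub>R sgn (y - c))"]
      exI[of _ "\<lambda>y. 1 / w (norm (y - c)) ^ (CARD('n) - 1)"])
     (auto intro!: continuous_intros)
qed

lemma scaling_map_regular:
  fixes c :: "real^'n"
  assumes "0 < a"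
  shows "regular_at (\<lambda>x. c + a *\<^sub>R (x - c)) y" "K_I (\<lambda>x. c + a *\<^sub>R (x - c)) y = 1"
proof -
  obtain e :: "real^'n" where e: "norm e = 1" using vector_choose_size zero_le_one by blast
  have d: "((\<lambda>x. c + a *\<^sub>R (x - c)) has_derivative (\<lambda>v. a *\<^sub>R v)) (at y)" for y
    by (auto intro!: derivative_eq_intros)
  show K: "K_I (\<lambda>x. c + a *\<^sub>R (x - c)) y = 1" for y
    using K_I_rank_one[OF e assms, of 1 "\<lambda>x. c + a *\<^sub>R (x - c)" y] d[of y] by simp
  show "regular_at (\<lambda>x. c + a *\<^sub>R (x - c)) y"
    unfolding regular_at_def using d K
    by (intro exI[of _ UNIV] exI[of _ "\<lambda>_ v. a *\<^sub>R v"] exI[of _ "\<lambda>_. 1"]) auto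
qed

lemma radial_map_center_regular:
  fixes c :: "real^'n"
  assumes "0 < \<delta>" and "\<And>r. 0 < r \<Longrightarrow> r < \<delta> \<Longrightarrow> S r = s"
  shows "regular_at (radial_map c S) c" "K_I (radial_map c S) c = 1"
proof -
  have eq: "c + exp s *\<^sub>R (y - c) = radial_map c S y" if "y \<in> ball c \<delta>" for y
    using that assms(2)[of "norm (y - c)"]
    by (cases "y = c") (auto simp: radial_map_def dist_norm norm_minus_commute)
  show "regular_at (radial_map c S) c"
    using regular_at_cong_open[of "ball c \<delta>" c "\<lambda>y. c + exp s *\<^sub>R (y - c)" "radial_map c S"]
      eq scaling_map_regular(1)[of "exp s" c c] assms(1) by simp
  show "K_I (radial_map c S) c = 1"
    using K_I_cong_open[of "ball c \<delta>" c "\<lambda>y. c + exp s *\<^sub>R (y - c)" "radial_map c S"]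
      eq scaling_map_regular(2)[of "exp s" c c] assms(1) by simp
qed

lemma norm_radial_map: "norm (radial_map c S x - c) = exp (S (norm (x - c))) * norm (x - c)"
  by (simp add: radial_map_def)

text \<open>For positive radii the modulus has derivative \<open>exp (S r) * w r\<close>. At radius
  0 nothing is known about \<open>S\<close>, but the modulus is 0 there and positive
  elsewhere.\<close>

lemma radial_profile_less:
  assumes S: "\<And>r. 0 < r \<Longrightarrow> (S has_real_derivative (w r - 1) / r) (at r)"
    and w: "\<And>r. 0 < r \<Longrightarrow> 0 < w r" and "0 \<le> a" "a < b"
  shows "exp (S a) * a < exp (S b) * (b::real)"
proof (cases "a = 0")
  case False
  then have a: "0 < a" using assms(3) by simp
  have "\<exists>y. ((\<lambda>r. exp (S r) * r) has_real_derivative y) (at r) \<and> 0 < y" if "a \<le> r" for r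
  proof -
    have r: "0 < r" using a that by simp
    have "((\<lambda>r. exp (S r) * r) has_real_derivative exp (S r) * w r) (at r)"
      using r by (auto intro!: derivative_eq_intros S simp: field_simps)
    then show ?thesis using w[OF r] by (intro exI[of _ "exp (S r) * w r"]) auto
  qed
  then show ?thesis using DERIV_pos_imp_increasing[OF assms(4), of "\<lambda>r. exp (S r) * r"] by blast
qed (use assms(4) in simp)

lemma inj_radial_map:
  assumes S: "\<And>r. 0 < r \<Longrightarrow> (S has_real_derivative (w r - 1) / r) (at r)"
    and w: "\<And>r. 0 < r \<Longrightarrow> 0 < w r"
  shows "inj (radial_map c S)"
proof (rule injI)
  fix x y assume eq: "radial_map c S x = radial_map c S y"
  then have "exp (S (norm (x - c))) * norm (x - c) = exp (S (norm (y - c))) * norm (y - c)"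
    using norm_radial_map[of c S x] norm_radial_map[of c S y] by simp
  then have "norm (x - c) = norm (y - c)"
    using radial_profile_less[OF S w, of "norm (x - c)" "norm (y - c)"]
      radial_profile_less[OF S w, of "norm (y - c)" "norm (x - c)"]
    by (cases "norm (x - c)" "norm (y - c)" rule: linorder_cases) auto
  then show "x = y" using eq by (simp add: radial_map_def)
qed

lemma radial_map_ident: "S (norm (x - c)) = 0 \<Longrightarrow> radial_map c S x = x"
  by (simp add: radial_map_def)

text \<open>This scales the profile to the ball of radius \<epsilon>. If \<open>Q\<close> vanishes
  on the non-negative half-line, the radial map is the identity outside that ball.\<close>

lemma inner_profile_deriv:
  assumes "\<And>s. (Q has_real_derivative (v s - 1)) (at s)" "0 < r" "0 < \<epsilon>"
  shows "((\<lambda>r. Q (ln (r / \<epsilon>))) has_real_derivative (v (ln (r / \<epsilon>)) - 1) / r) (at r)"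
proof -
  have "((\<lambda>r. ln (r / \<epsilon>)) has_real_derivative 1 / r) (at r)"
    using assms(2,3) by (auto intro!: derivative_eq_intros)
  from DERIV_chain2[OF assms(1) this] show ?thesis by simp
qed

text \<open>With \<open>s = ln (\<epsilon> / r)\<close> the modulus is
  \<open>\<epsilon> * exp (- (s + Q s))\<close>: the inner stretching conjugated by the inversion in
  the sphere of radius \<epsilon>. A lower bound for \<open>s + Q s\<close> keeps the image
  bounded.\<close>

lemma outer_profile_deriv:
  assumes "\<And>s. (Q has_real_derivative (v s - 1)) (at s)" "0 < r" "0 < \<epsilon>"
  shows "((\<lambda>r. - Q (ln (\<epsilon> / r))) has_real_derivative (v (ln (\<epsilon> / r)) - 1) / r) (at r)"
proof -
  have "((\<lambda>r. ln (\<epsilon> / r)) has_real_derivative - 1 / r) (at r)"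
    using assms(2,3) by (auto intro!: derivative_eq_intros simp: field_simps power2_eq_square)
  from DERIV_minus[OF DERIV_chain2[OF assms(1) this]] show ?thesis by (simp add: field_simps)
qed

lemma continuous_on_inner_profile:
  assumes "continuous_on UNIV v" "0 < \<epsilon>"
  shows "continuous_on {0<..} (\<lambda>r. v (ln (r / \<epsilon>) :: real) :: real)"
  by (rule continuous_on_compose2[OF assms(1)]) (use assms(2) in \<open>auto intro!: continuous_intros\<close>)

lemma continuous_on_outer_profile:
  assumes "continuous_on UNIV v" "0 < \<epsilon>"
  shows "continuous_on {0<..} (\<lambda>r. v (ln (\<epsilon> / r) :: real) :: real)"
  by (rule continuous_on_compose2[OF assms(1)]) (use assms(2) in \<open>auto intro!: continuous_intros\<close>)

text \<open>With the distance to the centre as \<open>a\<close> this gives the pole of order one in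
  the energy bound of an inner stretching; with the distance as \<open>b\<close>, the linear growth
  for an outer one.\<close>

lemma exp_max_ln_le:
  assumes "0 < a" "0 < (b::real)"
  shows "exp (max 0 (- ln (a / b))) \<le> 1 + b / a"
proof -
  have "- ln (a / b) = ln (b / a)" using assms by (simp add: ln_div)
  then show ?thesis using assms by (auto simp: max_def)
qed

section \<open>Weak derivatives of continuously differentiable maps\<close>

lemma lebesgue_integral_translation:
  fixes \<psi> :: "'a::euclidean_space \<Rightarrow> 'b::{banach, second_countable_topology}"
  assumes "\<psi> \<in> borel_measurable borel"
  shows "integral\<^sup>L lborel (\<lambda>x. \<psi> (x + a)) = integral\<^sup>L lborel \<psi>"
proof -
  have "integral\<^sup>L lborel \<psi> = integral\<^sup>L (distr lborel borel (\<lambda>x. a + x)) \<psi>"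
    by (simp add: lborel_distr_plus)
  also have "\<dots> = integral\<^sup>L lborel (\<lambda>x. \<psi> (a + x))"
    by (rule integral_distr) (use assms in auto)
  finally show ?thesis by (simp add: add.commute)
qed

text \<open>By translation invariance each difference quotient in the direction \<open>b\<close> has
  integral 0. The mean value inequality and the compact support provide the majorant for passing to
  the limit.\<close>

lemma integral_directional_derivative_eq_0:
  fixes \<psi> :: "'a::euclidean_space \<Rightarrow> 'b::euclidean_space"
  assumes der: "\<And>x. (\<psi> has_derivative \<psi>' x) (at x)"
    and cont: "continuous_on UNIV (\<lambda>x. \<psi>' x b)"
    and K: "compact K" "\<And>x. x \<notin> K \<Longrightarrow> \<psi> x = 0" "\<And>x. x \<notin> K \<Longrightarrow> \<psi>' x b = 0"
  shows "integral\<^sup>L lborel (\<lambda>x. \<psi>' x b) = 0"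
proof -
  have "continuous_on K (\<lambda>x. \<psi>' x b)" using cont by (rule continuous_on_subset) simp
  then have "bounded ((\<lambda>x. \<psi>' x b) ` K)" using K(1) compact_continuous_image compact_imp_bounded by blast
  then obtain B0 where B0: "\<And>x. x \<in> K \<Longrightarrow> norm (\<psi>' x b) \<le> B0" by (auto simp: bounded_iff)
  define B where "B = max 0 B0"
  have B: "norm (\<psi>' x b) \<le> B" for x
    using B0[of x] K(3)[of x] by (cases "x \<in> K") (auto simp: B_def)
  obtain R0 where R0: "\<And>x. x \<in> K \<Longrightarrow> norm x \<le> R0"
    using compact_imp_bounded[OF K(1)] by (auto simp: bounded_iff)
  \<comment> \<open>The step lengths \<open>h k\<close> are at most 1, so enlarging the radius by
    \<open>norm b\<close> catches the supports of all difference quotients.\<close>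
  define R where "R = R0 + norm b"
  define h where "h k = inverse (real (Suc k))" for k
  have h: "0 < h k" "h k \<le> 1" for k
    by (auto simp: h_def field_simps)
  define q where "q k x = (1 / h k) *\<^sub>R (\<psi> (x + h k *\<^sub>R b) - \<psi> x)" for k x
  have c\<psi>: "continuous_on UNIV \<psi>"
    using der by (meson continuous_at_imp_continuous_on has_derivative_continuous)
  have m\<psi>: "\<psi> \<in> borel_measurable borel" using c\<psi> by (rule borel_measurable_continuous_onI)
  have line: "((\<lambda>t. \<psi> (x + t *\<^sub>R b)) has_derivative (\<lambda>s. s *\<^sub>R \<psi>' (x + t *\<^sub>R b) b)) (at t within T)" for x t T
  proof -
    have "((\<lambda>t. x + t *\<^sub>R b) has_derivative (\<lambda>s. s *\<^sub>R b)) (at t within T)"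
      by (auto intro!: derivative_eq_intros)
    from has_derivative_compose[OF this der]
    have "((\<lambda>t. \<psi> (x + t *\<^sub>R b)) has_derivative (\<lambda>s. \<psi>' (x + t *\<^sub>R b) (s *\<^sub>R b))) (at t within T)" .
    moreover have "\<psi>' (x + t *\<^sub>R b) (s *\<^sub>R b) = s *\<^sub>R \<psi>' (x + t *\<^sub>R b) b" for s
      using has_derivative_linear[OF der] linear_scale by blast
    ultimately show ?thesis by simp
  qed
  have bound: "norm (\<psi> (x + t *\<^sub>R b) - \<psi> x) \<le> B * t" if "0 \<le> t" for x t
  proof -
    have "onorm (\<lambda>s. s *\<^sub>R \<psi>' y b) \<le> B" for y
    proof (rule onorm_bound)
      show "norm (s *\<^sub>R \<psi>' y b) \<le> B * norm s" for s
        using mult_left_mono[OF B[of y], of "\<bar>s\<bar>"] by (simp add: mult.commute)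
    qed (simp add: B_def)
    then have "norm ((\<lambda>t. \<psi> (x + t *\<^sub>R b)) t - (\<lambda>t. \<psi> (x + t *\<^sub>R b)) 0) \<le> B * norm (t - 0)"
      by (intro differentiable_bound[of "UNIV :: real set", OF _ line]) auto
    then show ?thesis using that by simp
  qed
  have q_bound: "norm (q k x) \<le> B * indicator (cball 0 R) x" for k x
  proof (cases "x \<in> cball 0 R")
    case True
    have "norm (q k x) \<le> 1 / h k * (B * h k)"
      using bound[of "h k" x] h[of k] by (simp add: q_def pos_divide_le_eq)
    then show ?thesis using True h[of k] by simp
  next
    case False
    have "norm (h k *\<^sub>R b) \<le> norm b"
      using h[of k] by (simp add: mult_left_le_one_le)
    then have "norm x \<le> norm (x + h k *\<^sub>R b) + norm b"
      using norm_triangle_ineq4[of "x + h k *\<^sub>R b" "h k *\<^sub>R b"] by simp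
    moreover have "R0 + norm b < norm x" using False by (simp add: R_def)
    ultimately have "R0 < norm (x + h k *\<^sub>R b)" "R0 < norm x"
      using norm_ge_zero[of b] by linarith+
    then have "x + h k *\<^sub>R b \<notin> K" "x \<notin> K"
      using R0[of "x + h k *\<^sub>R b"] R0[of x] by auto
    then show ?thesis using K(2) False by (simp add: q_def)
  qed
  have q_lim: "(\<lambda>k. q k x) \<longlonglongrightarrow> \<psi>' x b" for x
  proof -
    have "((\<lambda>t. \<psi> (x + t *\<^sub>R b)) has_vector_derivative \<psi>' x b) (at 0)"
      using line[of x 0 UNIV] by (simp add: has_vector_derivative_def)
    then have lim: "((\<lambda>t. norm (\<psi> (x + t *\<^sub>R b) - \<psi> x - t *\<^sub>R \<psi>' x b) / norm t) \<longlongrightarrow> 0) (at 0)"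
      unfolding has_vector_derivative_def has_derivative_at by simp
    have "((\<lambda>t. (1 / t) *\<^sub>R (\<psi> (x + t *\<^sub>R b) - \<psi> x) - \<psi>' x b) \<longlongrightarrow> 0) (at 0)"
    proof (rule tendsto_norm_zero_cancel, rule Lim_transform_eventually[OF lim])
      have "norm (\<psi> (x + t *\<^sub>R b) - \<psi> x - t *\<^sub>R \<psi>' x b) / norm t
          = norm ((1 / t) *\<^sub>R (\<psi> (x + t *\<^sub>R b) - \<psi> x) - \<psi>' x b)" if "t \<noteq> 0" for t
      proof -
        have "(1 / t) *\<^sub>R (\<psi> (x + t *\<^sub>R b) - \<psi> x) - \<psi>' x b
            = (1 / t) *\<^sub>R (\<psi> (x + t *\<^sub>R b) - \<psi> x - t *\<^sub>R \<psi>' x b)"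
          using that by (simp add: scaleR_diff_right)
        then show ?thesis by simp
      qed
      then show "\<forall>\<^sub>F t in at 0. norm (\<psi> (x + t *\<^sub>R b) - \<psi> x - t *\<^sub>R \<psi>' x b) / norm t
          = norm ((1 / t) *\<^sub>R (\<psi> (x + t *\<^sub>R b) - \<psi> x) - \<psi>' x b)"
        by (simp add: eventually_at_filter)
    qed
    then have "((\<lambda>t. (1 / t) *\<^sub>R (\<psi> (x + t *\<^sub>R b) - \<psi> x)) \<longlongrightarrow> \<psi>' x b) (at 0)"
      by (rule LIM_zero_cancel)
    moreover have "filterlim h (at 0) sequentially"
      unfolding filterlim_at using h LIMSEQ_inverse_real_of_nat
      by (auto simp: h_def[abs_def] less_imp_neq[symmetric])
    ultimately show ?thesis
      unfolding q_def by (rule filterlim_compose)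
  qed
  have "integrable lborel (\<lambda>x. B * indicator (cball (0::'a) R) x)"
    by (intro integrable_mult_right integrable_real_indicator) (use emeasure_bounded_finite[OF bounded_cball[of 0 R]] in \<open>auto simp: less_top[symmetric]\<close>)
  moreover have "q k \<in> borel_measurable lborel" for k
    unfolding q_def using c\<psi>
    by (auto intro!: borel_measurable_continuous_onI continuous_intros continuous_on_compose2[OF c\<psi>])
  moreover have "(\<lambda>x. \<psi>' x b) \<in> borel_measurable lborel"
    using borel_measurable_continuous_onI[OF cont] by simp
  ultimately have "(\<lambda>k. integral\<^sup>L lborel (q k)) \<longlonglongrightarrow> integral\<^sup>L lborel (\<lambda>x. \<psi>' x b)"
    using q_lim q_bound
    by (intro integral_dominated_convergence[where w = "\<lambda>x. B * indicator (cball 0 R) x"]) auto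
  moreover have "integral\<^sup>L lborel (q k) = 0" for k
  proof -
    have i: "integrable lborel \<psi>"
    proof -
      have "set_integrable lborel K \<psi>"
        unfolding set_integrable_def
        by (rule borel_integrable_compact) (use K(1) c\<psi> in \<open>auto intro: continuous_on_subset\<close>)
      then show ?thesis unfolding set_integrable_def
        by (rule Bochner_Integration.integrable_cong[THEN iffD1, rotated -1]) (use K(2) in \<open>auto simp: indicator_def\<close>)
    qed
    have "integrable lborel (\<lambda>x. \<psi> (x + h k *\<^sub>R b))"
    proof -
      have "integrable (distr lborel borel (\<lambda>x. h k *\<^sub>R b + x)) \<psi>"
        using i by (simp add: lborel_distr_plus)
      then show ?thesis
        by (subst (asm) integrable_distr_eq) (use m\<psi> in \<open>auto simp: add.commute\<close>)
    qed
    then show ?thesis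
      using i lebesgue_integral_translation[OF m\<psi>, of "h k *\<^sub>R b"] by (simp add: q_def[abs_def])
  qed
  ultimately show ?thesis by (simp add: LIMSEQ_const_iff)
qed

text \<open>The product of the test function with \<open>g\<close>, extended by 0, is continuously
  differentiable in direction \<open>b\<close> on the whole space and has compact support. Its
  derivative in that direction integrates to 0, and the product rule splits this integral into the
  two sides.\<close>

lemma weak_partial_C1:
  fixes g :: "real^'n \<Rightarrow> real^'n"
  assumes U: "open U"
    and der: "\<And>x. x \<in> U \<Longrightarrow> (g has_derivative g' x) (at x)"
    and cont: "continuous_on U (\<lambda>x. g' x b)" and b: "b \<in> Basis"
  shows "weak_partial U b g (\<lambda>x. g' x b)"
  unfolding weak_partial_def
proof (intro allI impI)
  fix \<phi> :: "real^'n \<Rightarrow> real" assume t: "test_fun U \<phi>"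
  define K where "K = closure {x. \<phi> x \<noteq> 0}"
  have K: "compact K" "K \<subseteq> U" "closed K"
    using t compact_imp_closed by (auto simp: test_fun_def K_def)
  have \<phi>0: "\<phi> x = 0" if "x \<notin> K" for x
    using that closure_subset[of "{x. \<phi> x \<noteq> 0}"] by (auto simp: K_def)
  have "Ck 1 \<phi>" using t by (simp add: test_fun_def)
  then have d\<phi>: "\<And>x. (\<phi> has_derivative frechet_derivative \<phi> (at x)) (at x)"
    and c\<phi>': "continuous_on UNIV (\<lambda>x. frechet_derivative \<phi> (at x) b)"
    using b by (auto simp: frechet_derivative_works)
  have c\<phi>: "continuous_on UNIV \<phi>"
    using d\<phi> by (meson continuous_at_imp_continuous_on has_derivative_continuous)
  have cg: "continuous_on U g"
    using der by (meson continuous_at_imp_continuous_on has_derivative_continuous)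
  have d0: "frechet_derivative \<phi> (at x) v = 0" if "x \<notin> K" for x v
  proof -
    have "(\<phi> has_derivative (\<lambda>_. 0)) (at x)"
      by (rule has_derivative_transform_within_open[of "\<lambda>_. 0" _ _ _ "- K"])
        (use K(3) that \<phi>0 in auto)
    then show ?thesis using frechet_derivative_at by metis
  qed
  define \<psi> where "\<psi> x = (if x \<in> U then \<phi> x *\<^sub>R g x else 0)" for x
  define \<psi>' where "\<psi>' x v = (if x \<in> U then \<phi> x *\<^sub>R g' x v + frechet_derivative \<phi> (at x) v *\<^sub>R g x else 0)" for x v
  have in_U: "(\<psi> has_derivative \<psi>' x) (at x)" if "x \<in> U" for x
  proof (rule has_derivative_transform_within_open[of "\<lambda>x. \<phi> x *\<^sub>R g x" _ _ _ U])
    show "((\<lambda>x. \<phi> x *\<^sub>R g x) has_derivative \<psi>' x) (at x)"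
      using has_derivative_scaleR[OF d\<phi> der[OF that]] that by (simp add: \<psi>'_def[abs_def])
  qed (use that U in \<open>auto simp: \<psi>_def\<close>)
  have out: "\<psi> x = 0" "\<psi>' x v = 0" if "x \<notin> K" for x v
    using that \<phi>0 d0 by (auto simp: \<psi>_def \<psi>'_def)
  have d\<psi>: "(\<psi> has_derivative \<psi>' x) (at x)" for x
  proof (cases "x \<in> U")
    case False
    then have "x \<in> - K" using K by auto
    moreover have "\<psi>' x = (\<lambda>_. 0)" using False by (auto simp: \<psi>'_def)
    ultimately show ?thesis
      using K(3) out by (auto intro: has_derivative_transform_within_open[of "\<lambda>_. 0" _ _ _ "- K"])
  qed (use in_U in auto)
  have c\<psi>': "continuous_on UNIV (\<lambda>x. \<psi>' x b)"
  proof -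
    have "continuous_on U (\<lambda>x. \<psi>' x b)"
    proof (rule continuous_on_cong[THEN iffD1, OF refl])
      show "continuous_on U (\<lambda>x. \<phi> x *\<^sub>R g' x b + frechet_derivative \<phi> (at x) b *\<^sub>R g x)"
        by (intro continuous_intros cont cg continuous_on_subset[OF c\<phi>] continuous_on_subset[OF c\<phi>']) auto
    qed (auto simp: \<psi>'_def)
    moreover have "continuous_on (- K) (\<lambda>x. \<psi>' x b)"
      by (rule continuous_on_cong[THEN iffD1, OF refl, of _ "\<lambda>_. 0"]) (use out in auto)
    ultimately have "continuous_on (U \<union> - K) (\<lambda>x. \<psi>' x b)"
      using U K(3) by (intro continuous_on_open_Un) auto
    moreover have "U \<union> - K = UNIV" using K by auto
    ultimately show ?thesis by simp
  qed
  have "integral\<^sup>L lborel (\<lambda>x. \<psi>' x b) = 0"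
    by (rule integral_directional_derivative_eq_0[OF d\<psi> c\<psi>' K(1)]) (use out in auto)
  have int: "integrable lborel (\<lambda>x. indicator U x *\<^sub>R F x)"
    if "continuous_on U F" "\<And>x. x \<notin> K \<Longrightarrow> F x = 0" for F :: "real^'n \<Rightarrow> real^'n"
  proof -
    have "set_integrable lborel K F"
      unfolding set_integrable_def
      by (rule borel_integrable_compact) (use K that in \<open>auto intro: continuous_on_subset\<close>)
    then show ?thesis unfolding set_integrable_def
      by (rule Bochner_Integration.integrable_cong[THEN iffD1, rotated -1])
        (use that(2) K(2) in \<open>auto simp: indicator_def\<close>)
  qed
  have i1: "integrable lborel (\<lambda>x. indicator U x *\<^sub>R (frechet_derivative \<phi> (at x) b *\<^sub>R g x))"
    by (intro int continuous_intros cg continuous_on_subset[OF c\<phi>']) (use d0 in auto)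
  have i2: "integrable lborel (\<lambda>x. indicator U x *\<^sub>R (\<phi> x *\<^sub>R g' x b))"
    by (intro int continuous_intros cont continuous_on_subset[OF c\<phi>]) (use \<phi>0 in auto)
  \<comment> \<open>Weak derivatives are defined with the completed measure, translation invariance
    was used for \<open>lborel\<close>; the integrals agree because the integrands are Borel
    measurable.\<close>
  have "(LINT x:U|lebesgue. frechet_derivative \<phi> (at x) b *\<^sub>R g x) + (LINT x:U|lebesgue. \<phi> x *\<^sub>R g' x b)
     = integral\<^sup>L lborel (\<lambda>x. indicator U x *\<^sub>R (frechet_derivative \<phi> (at x) b *\<^sub>R g x))
       + integral\<^sup>L lborel (\<lambda>x. indicator U x *\<^sub>R (\<phi> x *\<^sub>R g' x b))"
    unfolding set_lebesgue_integral_def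
    by (simp only: integral_completion[OF borel_measurable_integrable[OF i1]]
      integral_completion[OF borel_measurable_integrable[OF i2]])
  also have "\<dots> = integral\<^sup>L lborel (\<lambda>x. \<psi>' x b)"
    unfolding Bochner_Integration.integral_add[OF i1 i2, symmetric]
    by (intro Bochner_Integration.integral_cong) (auto simp: \<psi>'_def indicator_def)
  finally show "(LINT x:U|lebesgue. frechet_derivative \<phi> (at x) b *\<^sub>R g x) = - (LINT x:U|lebesgue. \<phi> x *\<^sub>R g' x b)"
    using \<open>integral\<^sup>L lborel (\<lambda>x. \<psi>' x b) = 0\<close> by (simp add: eq_neg_iff_add_eq_0)
qed

lemma in_Lp_bounded_continuous:
  fixes g :: "real^'n \<Rightarrow> real^'n"
  assumes "open U" "bounded U" "continuous_on U g" "\<And>x. x \<in> U \<Longrightarrow> norm (g x) \<le> B"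
  shows "in_Lp p U g"
  unfolding in_Lp_def
proof
  have "set_borel_measurable borel U g"
    unfolding set_borel_measurable_def
    using assms(1,3) by (intro borel_measurable_continuous_on_indicator) auto
  then show "set_borel_measurable lebesgue U g"
    unfolding set_borel_measurable_def by (simp add: measurable_completion)
  have "(\<integral>\<^sup>+x\<in>U. ennreal (norm (g x) ^ p) \<partial>lebesgue) \<le> (\<integral>\<^sup>+x. ennreal (B ^ p) * indicator U x \<partial>lebesgue)"
    by (intro nn_integral_mono) (auto simp: indicator_def intro!: ennreal_leI power_mono assms(4))
  also have "\<dots> = ennreal (B ^ p) * emeasure lebesgue U"
    using assms(1) by (intro nn_integral_cmult_indicator) auto
  also have "\<dots> < \<infinity>"
    using emeasure_bounded_finite[OF assms(2)] assms(1)
    by (simp add: ennreal_mult_less_top)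
  finally show "(\<integral>\<^sup>+x\<in>U. ennreal (norm (g x) ^ p) \<partial>lebesgue) < \<infinity>" .
qed

text \<open>On the compact ball \<open>cball x \<delta>\<close> the map and its partial derivatives
  are bounded, so on the open ball they lie in every \<open>L^p\<close>, and the classical partial
  derivatives are weak ones.\<close>

lemma sobolev_W1_C1:
  fixes g :: "real^'n \<Rightarrow> real^'n"
  assumes U: "open V" "cball x \<delta> \<subseteq> V"
    and der: "\<And>x. x \<in> V \<Longrightarrow> (g has_derivative g' x) (at x)"
    and cont: "\<And>b. continuous_on V (\<lambda>x. g' x b)"
  shows "sobolev_W1 p (ball x \<delta>) g"
proof -
  have sub: "ball x \<delta> \<subseteq> V" using U(2) ball_subset_cball by blast
  have Lp: "in_Lp p (ball x \<delta>) F" if F: "continuous_on V F" for F :: "real^'n \<Rightarrow> real^'n"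
  proof -
    have "bounded (F ` cball x \<delta>)"
      using F U(2) by (meson compact_cball compact_continuous_image compact_imp_bounded continuous_on_subset)
    then obtain B where "\<And>y. y \<in> cball x \<delta> \<Longrightarrow> norm (F y) \<le> B" unfolding bounded_iff by blast
    then show ?thesis
      using F sub by (intro in_Lp_bounded_continuous[of _ _ B]) (auto intro: continuous_on_subset)
  qed
  have "continuous_on V g"
    using der by (meson continuous_at_imp_continuous_on has_derivative_continuous)
  then show ?thesis unfolding sobolev_W1_def
    using Lp cont weak_partial_C1[OF open_ball der continuous_on_subset[OF cont sub]] sub by blast
qed

lemma sobolev_W1_cong:
  assumes "\<And>x. x \<in> U \<Longrightarrow> g x = h x"
  shows "sobolev_W1 p U g \<longleftrightarrow> sobolev_W1 p U h"
proof -
  have "set_borel_measurable lebesgue U g = set_borel_measurable lebesgue U h"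
    unfolding set_borel_measurable_def
    by (rule arg_cong[where f="\<lambda>F. F \<in> _"]) (use assms in \<open>auto simp: indicator_def fun_eq_iff\<close>)
  moreover have "(\<integral>\<^sup>+x\<in>U. ennreal (norm (g x) ^ p) \<partial>lebesgue) = (\<integral>\<^sup>+x\<in>U. ennreal (norm (h x) ^ p) \<partial>lebesgue)"
    by (rule nn_integral_cong) (use assms in \<open>auto simp: indicator_def\<close>)
  moreover have "(LINT x:U|lebesgue. a x *\<^sub>R g x) = (LINT x:U|lebesgue. a x *\<^sub>R h x)" for a :: "_ \<Rightarrow> real"
    unfolding set_lebesgue_integral_def
    by (rule Bochner_Integration.integral_cong) (use assms in \<open>auto simp: indicator_def\<close>)
  ultimately show ?thesis
    unfolding sobolev_W1_def in_Lp_def weak_partial_def by simp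
qed

section \<open>The topology of the extended space and membership in the classes\<close>

lemma one_le_sqrt_norm: "1 \<le> sqrt (1 + (norm x)\<^sup>2)"
  by simp

lemma sqrt_norm_pos: "0 < sqrt (1 + (norm x)\<^sup>2)"
  using one_le_sqrt_norm[of x] by linarith

lemma chordal_Some_le: "chordal (Some x) (Some y) \<le> norm (x - y)"
proof -
  have "1 \<le> sqrt (1 + (norm x)\<^sup>2) * sqrt (1 + (norm y)\<^sup>2)"
    using mult_mono[OF one_le_sqrt_norm[of x] one_le_sqrt_norm[of y]] by simp
  then show ?thesis
    using divide_left_mono[of 1 "sqrt (1 + (norm x)\<^sup>2) * sqrt (1 + (norm y)\<^sup>2)" "norm (x - y)"] by simp
qed

text \<open>\<open>t / (1 + norm x + t)\<close> increases with \<open>t\<close>, so Euclidean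
  separation from a fixed \<open>x\<close> bounds the chordal distance from below even when
  \<open>y\<close> is arbitrarily far away.\<close>

lemma chordal_Some_ge:
  assumes "e \<le> norm (x - y)" "0 < e"
  shows "e / (sqrt (1 + (norm x)\<^sup>2) * (1 + norm x + e)) \<le> chordal (Some x) (Some y)"
proof -
  define t where "t = norm (x - y)"
  have "norm y \<le> norm x + t"
    unfolding t_def using norm_triangle_ineq4[of x "x - y"] by simp
  moreover have "sqrt (1 + (norm y)\<^sup>2) \<le> 1 + norm y"
    by (rule real_le_lsqrt) (auto simp: power2_eq_square algebra_simps)
  ultimately have y: "sqrt (1 + (norm y)\<^sup>2) \<le> 1 + norm x + t" by simp
  have pos: "0 < 1 + norm x + e" "0 < 1 + norm x + t"
    using assms norm_ge_zero[of x] unfolding t_def by linarith+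
  have "e * (1 + norm x + t) \<le> t * (1 + norm x + e)"
    using assms mult_right_mono[of e t "1 + norm x"] by (simp add: t_def algebra_simps)
  then have "e / (1 + norm x + e) \<le> t / (1 + norm x + t)"
    using pos by (simp add: field_simps)
  also have "\<dots> \<le> t / sqrt (1 + (norm y)\<^sup>2)"
    using y sqrt_norm_pos[of y] pos by (intro divide_left_mono mult_pos_pos) (auto simp: t_def)
  finally have "e / (1 + norm x + e) / sqrt (1 + (norm x)\<^sup>2)
      \<le> t / sqrt (1 + (norm y)\<^sup>2) / sqrt (1 + (norm x)\<^sup>2)"
    by (rule divide_right_mono) simp
  then show ?thesis by (simp add: t_def mult.commute)
qed

text \<open>This identifies the chordal topology with that of the one-point compactification, so
  that later continuity and openness arguments are Euclidean.\<close>

lemma openin_xtop_iff: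
  "openin xtop V \<longleftrightarrow> open {x. Some x \<in> V} \<and> (None \<in> V \<longrightarrow> (\<exists>R. \<forall>x. norm x > R \<longrightarrow> Some x \<in> V))"
proof
  assume V: "openin xtop V"
  show "open {x. Some x \<in> V} \<and> (None \<in> V \<longrightarrow> (\<exists>R. \<forall>x. norm x > R \<longrightarrow> Some x \<in> V))"
  proof (intro conjI impI)
    show "open {x. Some x \<in> V}"
      unfolding open_dist
    proof
      fix x assume "x \<in> {x. Some x \<in> V}"
      then obtain r where r: "r > 0" "chordal.mball (Some x) r \<subseteq> V"
        using V unfolding chordal.openin_mtopology by auto
      have "Some y \<in> V" if "dist y x < r" for y
        using that chordal_Some_le[of x y] r(2)
        by (auto simp: chordal.mball_def subset_iff dist_norm norm_minus_commute)
      then show "\<exists>e>0. \<forall>y. dist y x < e \<longrightarrow> y \<in> {x. Some x \<in> V}" using r(1) by blast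
    qed
    assume "None \<in> V"
    then obtain r where r: "r > 0" "chordal.mball None r \<subseteq> V"
      using V unfolding chordal.openin_mtopology by auto
    have "Some x \<in> V" if "norm x > 1 / r" for x
    proof -
      have "norm x < sqrt (1 + (norm x)\<^sup>2)" by (rule real_less_rsqrt) simp
      then have "1 / r < sqrt (1 + (norm x)\<^sup>2)" using that by simp
      then have "1 / sqrt (1 + (norm x)\<^sup>2) < r"
        using r(1) sqrt_norm_pos[of x] by (simp only: pos_divide_less_eq mult.commute)
      then show ?thesis using r(2) by (auto simp: subset_iff)
    qed
    then show "\<exists>R. \<forall>x. norm x > R \<longrightarrow> Some x \<in> V" by blast
  qed
next
  assume V: "open {x. Some x \<in> V} \<and> (None \<in> V \<longrightarrow> (\<exists>R. \<forall>x. norm x > R \<longrightarrow> Some x \<in> V))"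
  show "openin xtop V"
    unfolding chordal.openin_mtopology
  proof (intro conjI allI impI)
    fix p assume p: "p \<in> V"
    show "\<exists>r>0. chordal.mball p r \<subseteq> V"
    proof (cases p)
      case (Some x)
      then obtain e where e: "e > 0" "\<And>y. dist y x < e \<Longrightarrow> Some y \<in> V"
        using V p unfolding open_dist by blast
      \<comment> \<open>The chordal lower bound for points at Euclidean distance at least
        \<open>e\<close>. It is also at most the chordal distance from \<open>Some x\<close> to
        infinity, so the chordal ball does not contain infinity.\<close>
      define r where "r = e / (sqrt (1 + (norm x)\<^sup>2) * (1 + norm x + e))"
      have pos: "0 < sqrt (1 + (norm x)\<^sup>2)" using one_le_sqrt_norm[of x] by linarith
      have "r > 0" using e(1) pos by (auto simp: r_def intro!: divide_pos_pos mult_pos_pos add_nonneg_pos)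
      moreover have "chordal.mball p r \<subseteq> V"
      proof
        fix q assume "q \<in> chordal.mball p r"
        then have q: "chordal (Some x) q < r" using Some by simp
        show "q \<in> V"
        proof (cases q)
          case None
          have "r = (e / (1 + norm x + e)) * (1 / sqrt (1 + (norm x)\<^sup>2))"
            by (simp add: r_def)
          also have "\<dots> \<le> 1 * (1 / sqrt (1 + (norm x)\<^sup>2))"
            using e(1) norm_ge_zero[of x] pos by (intro mult_right_mono) (auto simp: divide_le_eq_1)
          finally show ?thesis using q None by simp
        next
          case (Some y)
          then have "norm (x - y) < e"
            using q chordal_Some_ge[of e x y] e(1) unfolding r_def by (meson not_le)
          then show ?thesis using e(2)[of y] Some by (simp add: dist_norm norm_minus_commute)
        qed
      qed
      ultimately show ?thesis by blast
    next
      case None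
      then obtain R where R: "\<And>x. norm x > R \<Longrightarrow> Some x \<in> V" using V p by blast
      define R' where "R' = max 0 R"
      have "chordal.mball p (1 / sqrt (1 + R'\<^sup>2)) \<subseteq> V"
      proof
        fix q assume q: "q \<in> chordal.mball p (1 / sqrt (1 + R'\<^sup>2))"
        show "q \<in> V"
        proof (cases q)
          case (Some y)
          have "1 / sqrt (1 + (norm y)\<^sup>2) < 1 / sqrt (1 + R'\<^sup>2)" using q Some None by simp
          then have "sqrt (1 + R'\<^sup>2) < sqrt (1 + (norm y)\<^sup>2)"
            using frac_le[of 1 1 "sqrt (1 + (norm y)\<^sup>2)" "sqrt (1 + R'\<^sup>2)"] sqrt_norm_pos[of y] by linarith
          then have "R'\<^sup>2 < (norm y)\<^sup>2" by simp
          then have "R' < norm y" by (rule power2_less_imp_less) simp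
          then show ?thesis using R Some by (simp add: R'_def)
        qed (use p None in auto)
      qed
      moreover have "1 / sqrt (1 + R'\<^sup>2) > 0" by (simp add: add_pos_nonneg)
      ultimately show ?thesis by blast
    qed
  qed simp
qed

lemma Some_in_map_option_image:
  "Some y \<in> map_option g ` V \<longleftrightarrow> (\<exists>x. Some x \<in> V \<and> g x = y)"
proof
  assume "Some y \<in> map_option g ` V"
  then obtain p where "p \<in> V" "Some y = map_option g p" by (rule imageE)
  then show "\<exists>x. Some x \<in> V \<and> g x = y" by (cases p) auto
next
  assume "\<exists>x. Some x \<in> V \<and> g x = y"
  then obtain x where "Some x \<in> V" "y = g x" by auto
  then show "Some y \<in> map_option g ` V" by (auto intro!: image_eqI[of _ _ "Some x"])
qed

text \<open>Openness at finite points is invariance of domain. If infinity lies in \<open>D\<close>,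
  the map is the identity near it, and continuity and openness there come for free.\<close>

lemma embedding_map_map_option:
  fixes D :: "(real^'n) option set" and g :: "real^'n \<Rightarrow> real^'n"
  assumes D: "openin xtop D"
    and cont: "continuous_on {x. Some x \<in> D} g" and inj: "inj_on g {x. Some x \<in> D}"
    and inf: "None \<in> D \<Longrightarrow> \<exists>R. \<forall>x. norm x > R \<longrightarrow> g x = x"
  shows "embedding_map (subtopology xtop D) xtop (map_option g)"
proof (rule injective_open_imp_embedding_map)
  let ?\<Omega> = "{x. Some x \<in> D}"
  have \<Omega>: "open ?\<Omega>" using D by (simp add: openin_xtop_iff)
  show "continuous_map (subtopology xtop D) xtop (map_option g)"
    unfolding continuous_map_def
  proof (intro conjI allI impI)
    fix W :: "(real^'n) option set" assume W: "openin xtop W"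
    let ?V = "{p \<in> topspace (subtopology xtop D). map_option g p \<in> W}"
    have fin: "{x. Some x \<in> ?V} = ?\<Omega> \<inter> g -` {y. Some y \<in> W}" by auto
    have "open {x. Some x \<in> ?V}"
      unfolding fin using cont \<Omega> W by (intro continuous_open_preimage) (auto simp: openin_xtop_iff)
    moreover have "\<exists>R. \<forall>x. norm x > R \<longrightarrow> Some x \<in> ?V" if "None \<in> ?V"
    proof -
      from that have "None \<in> D" "None \<in> W" by auto
      then obtain R1 R2 R3 where "\<And>x. norm x > R1 \<Longrightarrow> g x = x" "\<And>x. norm x > R2 \<Longrightarrow> Some x \<in> D"
         "\<And>x. norm x > R3 \<Longrightarrow> Some x \<in> W"
        using inf D W unfolding openin_xtop_iff by meson
      then show ?thesis by (intro exI[of _ "max R1 (max R2 R3)"]) auto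
    qed
    ultimately have "openin xtop ?V" unfolding openin_xtop_iff by blast
    then show "openin (subtopology xtop D) ?V"
      using D by (simp add: openin_open_subtopology)
  qed auto
  show "open_map (subtopology xtop D) xtop (map_option g)"
    unfolding open_map_def
  proof (intro allI impI)
    fix V assume "openin (subtopology xtop D) V"
    then have V: "openin xtop V" "V \<subseteq> D" using D by (auto simp: openin_open_subtopology)
    have fin: "{y. Some y \<in> map_option g ` V} = g ` {x. Some x \<in> V}"
      unfolding Some_in_map_option_image by auto
    have "open (g ` {x. Some x \<in> V})"
      using V cont inj by (intro invariance_of_domain)
        (auto simp: openin_xtop_iff elim: continuous_on_subset inj_on_subset)
    moreover have "\<exists>R. \<forall>y. norm y > R \<longrightarrow> Some y \<in> map_option g ` V" if "None \<in> map_option g ` V"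
    proof -
      from that have "None \<in> V" by auto
      moreover from this have "None \<in> D" using V by auto
      ultimately obtain R1 R2 where R: "\<And>x. norm x > R1 \<Longrightarrow> g x = x" "\<And>x. norm x > R2 \<Longrightarrow> Some x \<in> V"
        using inf V unfolding openin_xtop_iff by meson
      have "Some y \<in> map_option g ` V" if "norm y > max R1 R2" for y
        using that R[of y] by (intro image_eqI[of _ _ "Some y"]) auto
      then show ?thesis by blast
    qed
    ultimately show "openin xtop (map_option g ` V)"
      unfolding openin_xtop_iff fin by blast
  qed
  show "inj_on (map_option g) (topspace (subtopology xtop D))"
  proof (rule inj_onI)
    fix p q assume "p \<in> topspace (subtopology xtop D)" "q \<in> topspace (subtopology xtop D)"
      "map_option g p = map_option g q"
    then show "p = q" using inj by (cases p; cases q) (auto dest: inj_onD)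
  qed
qed

section \<open>Verifying membership in the classes\<close>

lemma local_rep_map_option_Some [simp]: "local_rep (map_option g) (Some x) = g"
  by (simp add: fun_eq_iff local_rep_def xcoord_def xchart_def)

lemma xK_I_map_option_Some [simp]: "xK_I (map_option g) (Some x) = K_I g x"
  by (simp add: xK_I_def xcoord_def)

lemma K_I_integrable_ball:
  fixes h :: "real^'n \<Rightarrow> real^'n"
  assumes "cball x \<delta> \<subseteq> V" "\<And>y. y \<in> V \<Longrightarrow> K_I h y = ennreal (\<kappa> y)" "continuous_on V \<kappa>"
  shows "(\<lambda>y. K_I h y * indicator (ball x \<delta>) y) \<in> borel_measurable lebesgue"
    "(\<integral>\<^sup>+y\<in>ball x \<delta>. K_I h y \<partial>lebesgue) < \<infinity>"
proof -
  have sub: "ball x \<delta> \<subseteq> V" using assms(1) ball_subset_cball by blast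
  have eq: "K_I h y * indicator (ball x \<delta>) y = ennreal (indicator (ball x \<delta>) y *\<^sub>R \<kappa> y)" for y
    using assms(2)[of y] sub by (auto simp: indicator_def)
  have "(\<lambda>y. indicator (ball x \<delta>) y *\<^sub>R \<kappa> y) \<in> borel_measurable borel"
    by (rule borel_measurable_continuous_on_indicator) (use assms(3) sub in \<open>auto intro: continuous_on_subset\<close>)
  then have "(\<lambda>y. ennreal (indicator (ball x \<delta>) y *\<^sub>R \<kappa> y)) \<in> borel_measurable lborel" by simp
  then show "(\<lambda>y. K_I h y * indicator (ball x \<delta>) y) \<in> borel_measurable lebesgue"
    unfolding eq by (rule measurable_completion)
  have "bounded (\<kappa> ` cball x \<delta>)"
    using assms(1,3) by (meson compact_cball compact_continuous_image compact_imp_bounded continuous_on_subset)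
  then obtain B where B: "\<And>y. y \<in> cball x \<delta> \<Longrightarrow> norm (\<kappa> y) \<le> B" unfolding bounded_iff by blast
  have "(\<integral>\<^sup>+y\<in>ball x \<delta>. K_I h y \<partial>lebesgue) \<le> (\<integral>\<^sup>+y. ennreal B * indicator (ball x \<delta>) y \<partial>lebesgue)"
  proof (rule nn_integral_mono)
    fix y
    show "K_I h y * indicator (ball x \<delta>) y \<le> ennreal B * indicator (ball x \<delta>) y"
      using assms(2)[of y] sub B[of y] by (auto simp: indicator_def intro!: ennreal_leI)
  qed
  also have "\<dots> = ennreal B * emeasure lebesgue (ball x \<delta>)"
    by (rule nn_integral_cmult_indicator) auto
  also have "\<dots> < \<infinity>"
    using emeasure_bounded_finite[OF bounded_ball[of x \<delta>]] by (simp add: ennreal_mult_less_top)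
  finally show "(\<integral>\<^sup>+y\<in>ball x \<delta>. K_I h y \<partial>lebesgue) < \<infinity>" .
qed

text \<open>Where \<open>g\<close> is the identity far out, it is also the identity in the inverted
  coordinate near 0. All radii up to \<delta> are offered because the integrability estimates need a
  closed ball inside the region of validity.\<close>

lemma coord_nbhd_infinity:
  fixes D :: "(real^'n) option set" and g :: "real^'n \<Rightarrow> real^'n"
  assumes D: "openin xtop D" "None \<in> D"
    and inf: "\<exists>R. \<forall>x. norm x > R \<longrightarrow> g x = x"
  obtains \<delta> where "0 < \<delta>"
    "\<And>\<epsilon>. 0 < \<epsilon> \<Longrightarrow> \<epsilon> \<le> \<delta> \<Longrightarrow> coord_nbhd D (map_option g) None (ball 0 \<epsilon>)"
    "\<And>x. x \<in> ball 0 \<delta> \<Longrightarrow> local_rep (map_option g) None x = x"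
proof -
  obtain R1 R2 where R: "\<And>x. norm x > R1 \<Longrightarrow> g x = x" "\<And>x. norm x > R2 \<Longrightarrow> Some x \<in> D"
    using inf D unfolding openin_xtop_iff by meson
  define R where "R = max 1 (max R1 R2)"
  have far: "g ((1 / (norm x)\<^sup>2) *\<^sub>R x) = (1 / (norm x)\<^sup>2) *\<^sub>R x" "Some ((1 / (norm x)\<^sup>2) *\<^sub>R x) \<in> D"
    if "x \<in> ball 0 (1 / R)" "x \<noteq> 0" for x
  proof -
    have "norm ((1 / (norm x)\<^sup>2) *\<^sub>R x) = 1 / norm x"
      using that(2) by (simp add: power2_eq_square)
    also have "\<dots> > R"
    proof -
      have "R > 0" by (simp add: R_def)
      then show ?thesis using that by (simp add: pos_less_divide_eq mult.commute)
    qed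
    finally have "norm ((1 / (norm x)\<^sup>2) *\<^sub>R x) > R" .
    then show "g ((1 / (norm x)\<^sup>2) *\<^sub>R x) = (1 / (norm x)\<^sup>2) *\<^sub>R x" "Some ((1 / (norm x)\<^sup>2) *\<^sub>R x) \<in> D"
      by (auto intro: R simp: R_def)
  qed
  show thesis
  proof
    show "0 < 1 / R" by (simp add: R_def)
    show "local_rep (map_option g) None x = x" if "x \<in> ball 0 (1 / R)" for x
      using far[OF that] by (auto simp: local_rep_def xcoord_def xchart_def power2_eq_square)
    show "coord_nbhd D (map_option g) None (ball 0 \<epsilon>)" if \<epsilon>: "0 < \<epsilon>" "\<epsilon> \<le> 1 / R" for \<epsilon>
      unfolding coord_nbhd_def
    proof (intro conjI ballI)
      fix x :: "real^'n" assume "x \<in> ball 0 \<epsilon>"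
      then have x: "x \<in> ball 0 (1 / R)" using \<epsilon> by auto
      show "xchart None x \<in> D" using far[OF x] D(2) by (auto simp: xchart_def)
      have "map_option g (xchart None x) = xchart None x" using far[OF x] by (auto simp: xchart_def)
      then show "map_option g (xchart None x) \<in> range (xchart (map_option g None))" by auto
    qed (use \<epsilon> in \<open>auto simp: xcoord_def\<close>)
  qed
qed

lemma coord_nbhd_finite:
  fixes D :: "(real^'n) option set"
  assumes "cball x \<delta> \<subseteq> {x. Some x \<in> D}" "0 < \<delta>"
  shows "coord_nbhd D (map_option g) (Some x) (ball x \<delta>)"
  using assms by (auto simp: coord_nbhd_def xcoord_def xchart_def[abs_def] subset_iff)

text \<open>Two omitted points \<open>q1\<close> and \<open>q2\<close> certify the lower bound for
  the diameter of the omitted set. Local conditions come from \<open>regular_at\<close> at finite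
  points and from the identity near infinity.\<close>

lemma map_option_in_S_class:
  fixes D :: "(real^'n) option set" and g :: "real^'n \<Rightarrow> real^'n"
  assumes D: "openin xtop D"
    and inj: "inj_on g {x. Some x \<in> D}"
    and reg: "\<And>x. Some x \<in> D \<Longrightarrow> regular_at g x"
    and inf: "None \<in> D \<Longrightarrow> \<exists>R. \<forall>x. norm x > R \<longrightarrow> g x = x"
    and q: "q1 \<notin> map_option g ` D" "q2 \<notin> map_option g ` D" "\<Delta> \<le> chordal q1 q2"
    and M: "(\<integral>\<^sup>+x\<in>{x. Some x \<in> D}. \<Phi> (K_I g x) * ennreal (1 / (1 + (norm x)\<^sup>2) ^ CARD('n)) \<partial>lebesgue) \<le> ennreal M"
  shows "map_option g \<in> S_class D \<Phi> M \<Delta>"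
proof -
  let ?\<Omega> = "{x. Some x \<in> D}"
  have \<Omega>: "open ?\<Omega>" using D by (simp add: openin_xtop_iff)
  have cont: "continuous_on ?\<Omega> g"
  proof (intro continuous_at_imp_continuous_on ballI)
    fix x assume "x \<in> ?\<Omega>"
    then obtain g' where "(g has_derivative g' x) (at x)"
      using reg[of x] unfolding regular_at_def by blast
    then show "isCont g x" by (rule has_derivative_continuous)
  qed
  have loc: "\<exists>U. coord_nbhd D (map_option g) p U \<and> sobolev_W1 CARD('n) U (local_rep (map_option g) p) \<and>
      (\<lambda>x. K_I (local_rep (map_option g) p) x * indicator U x) \<in> borel_measurable lebesgue \<and>
        (\<integral>\<^sup>+x\<in>U. K_I (local_rep (map_option g) p) x \<partial>lebesgue) < \<infinity>" if p: "p \<in> D" for p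
  proof (cases p)
    case (Some x)
    obtain V g' \<kappa> where V: "open V" "x \<in> V"
     "\<And>y. y\<in>V \<Longrightarrow> (g has_derivative g' y) (at y)" "\<And>y. y\<in>V \<Longrightarrow> K_I g y = ennreal (\<kappa> y)"
     "continuous_on V \<kappa>" "\<And>b. continuous_on V (\<lambda>y. g' y b)"
      using reg[of x] p Some unfolding regular_at_def by blast
    obtain \<delta> where \<delta>: "\<delta> > 0" "cball x \<delta> \<subseteq> V \<inter> ?\<Omega>"
      using open_contains_cball[of "V \<inter> ?\<Omega>"] V(1,2) \<Omega> p Some by blast
    show ?thesis
      using coord_nbhd_finite[of x \<delta> D g] sobolev_W1_C1[OF V(1) _ V(3) V(6), of x \<delta>]
        K_I_integrable_ball[of x \<delta> V g \<kappa>] V(4,5) \<delta> Some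
      by (intro exI[of _ "ball x \<delta>"]) auto
  next
    case None
    let ?l = "local_rep (map_option g) None"
    obtain \<delta> where \<delta>: "0 < \<delta>"
      "\<And>\<epsilon>. 0 < \<epsilon> \<Longrightarrow> \<epsilon> \<le> \<delta> \<Longrightarrow> coord_nbhd D (map_option g) None (ball 0 \<epsilon>)"
      "\<And>x. x \<in> ball 0 \<delta> \<Longrightarrow> ?l x = x"
      using coord_nbhd_infinity[OF D _ inf] p None by blast
    have K: "K_I ?l x = ennreal 1" if "x \<in> ball 0 \<delta>" for x
      using K_I_cong_open[of "ball 0 \<delta>" x ?l "\<lambda>x. 0 + 1 *\<^sub>R (x - 0)"] \<delta>(3) that
        scaling_map_regular(2)[of 1 "0::real^'n" x] by simp
    have sub: "cball (0::real^'n) (\<delta> / 2) \<subseteq> ball 0 \<delta>" using \<delta>(1) by auto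
    have "sobolev_W1 CARD('n) (ball (0::real^'n) (\<delta> / 2)) (\<lambda>x. x)"
      by (rule sobolev_W1_C1[of UNIV _ _ _ "\<lambda>_ v. v"]) (auto intro: has_derivative_ident)
    moreover have "sobolev_W1 CARD('n) (ball (0::real^'n) (\<delta> / 2)) ?l
        = sobolev_W1 CARD('n) (ball (0::real^'n) (\<delta> / 2)) (\<lambda>x. x)"
      by (rule sobolev_W1_cong) (use \<delta>(1,3) in auto)
    ultimately show ?thesis
      using \<delta>(1,2) None K_I_integrable_ball[of 0 "\<delta> / 2" "ball 0 \<delta>" ?l "\<lambda>_. 1", OF sub K]
      by (intro exI[of _ "ball 0 (\<delta> / 2)"]) (auto simp del: mem_ball)
  qed
  have "ennreal (chordal q1 q2) \<le> chordal_diam (UNIV - map_option g ` D)"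
    unfolding chordal_diam_def using q(1,2)
    by (intro SUP_upper2[of q1] SUP_upper2[of q2]) auto
  then have "ennreal \<Delta> \<le> chordal_diam (UNIV - map_option g ` D)"
    using q(3) by (meson ennreal_leI order_trans)
  moreover have "W1n_loc D (map_option g)" unfolding W1n_loc_def using loc by blast
  moreover have "K_I_loc_integrable D (map_option g)" unfolding K_I_loc_integrable_def using loc by blast
  ultimately show ?thesis
    unfolding S_class_def using embedding_map_map_option[OF D cont inj inf] M by simp
qed

text \<open>Against normality, the compact set formed by the sequence and its limit is used: uniform
  convergence on it to a continuous map would make some displacement smaller than
  \<open>3 * (\<eta> / 4)\<close>. Both alternatives of the hypothesis are thus refuted
  directly.\<close>

lemma not_equicontinuous_not_normal:
  fixes D :: "(real^'n) option set"
  assumes f: "\<And>m. f m \<in> F" and x: "\<And>m. x m \<in> D" "x0 \<in> D" "limitin xtop x x0 sequentially"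
    and \<eta>: "0 < \<eta>" "\<And>m::nat. \<eta> \<le> chordal (f m (x m)) (f m x0)"
  shows "\<not> equicontinuous_fam D F" "\<not> normal_fam D F"
proof -
  show "\<not> equicontinuous_fam D F"
  proof
    assume "equicontinuous_fam D F"
    then obtain U where U: "openin (subtopology xtop D) U" "x0 \<in> U"
        "\<And>y h. y \<in> U \<Longrightarrow> h \<in> F \<Longrightarrow> chordal (h y) (h x0) < \<eta>"
      unfolding equicontinuous_fam_def using x(2) \<eta>(1) by meson
    obtain V where V: "openin xtop V" "U = V \<inter> D" using U(1) by (auto simp: openin_subtopology)
    then have "\<forall>\<^sub>F m in sequentially. x m \<in> V" using x(3) U(2) by (auto simp: limitin_def)
    then obtain m where "x m \<in> V" by (auto simp: eventually_sequentially)
    then have "chordal (f m (x m)) (f m x0) < \<eta>" using U(3) V x(1) f by auto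
    then show False using \<eta>(2)[of m] by simp
  qed
  show "\<not> normal_fam D F"
  proof
    assume "normal_fam D F"
    moreover have "range f \<subseteq> F" using f by auto
    ultimately have "\<exists>(r :: nat \<Rightarrow> nat) g. strict_mono r \<and> continuous_map (subtopology xtop D) xtop g \<and>
        (\<forall>C. C \<subseteq> D \<and> compactin xtop C \<longrightarrow>
          (\<forall>\<epsilon>>0. \<exists>N. \<forall>k\<ge>N. \<forall>y\<in>C. chordal (f (r k) y) (g y) < \<epsilon>))"
      unfolding normal_fam_def by (elim allE[of _ f] impE)
    then obtain r :: "nat \<Rightarrow> nat" and g where r: "strict_mono r" and g: "continuous_map (subtopology xtop D) xtop g"
      and conv: "\<forall>C. C \<subseteq> D \<and> compactin xtop C \<longrightarrow>
        (\<forall>\<epsilon>>0. \<exists>N. \<forall>k\<ge>N. \<forall>y\<in>C. chordal (f (r k) y) (g y) < \<epsilon>)"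
      by (elim exE conjE)
    have cpt: "compactin xtop (insert x0 (range x))"
      by (rule compactin_sequence_with_limit[OF x(3)]) auto
    have sub: "insert x0 (range x) \<subseteq> D" using x by auto
    have "\<forall>\<epsilon>>0. \<exists>N. \<forall>k\<ge>N. \<forall>y\<in>insert x0 (range x). chordal (f (r k) y) (g y) < \<epsilon>"
      by (rule mp[OF spec[OF conv] conjI[OF sub cpt]])
    moreover have "0 < \<eta> / 4" using \<eta>(1) by simp
    ultimately obtain N where N: "\<forall>k\<ge>N. \<forall>y\<in>insert x0 (range x). chordal (f (r k) y) (g y) < \<eta> / 4"
      by meson
    have "limitin (subtopology xtop D) x x0 sequentially"
      using x by (simp add: limitin_subtopology)
    from continuous_map_limit[OF g this] have "limitin xtop (g \<circ> x) (g x0) sequentially" .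
    then have "\<forall>\<^sub>F m in sequentially. chordal (g (x m)) (g x0) < \<eta> / 4"
      using \<eta>(1) unfolding chordal.limitin_metric by (auto dest!: spec[of _ "\<eta> / 4"])
    then obtain N' where N': "\<And>m. N' \<le> m \<Longrightarrow> chordal (g (x m)) (g x0) < \<eta> / 4"
      by (auto simp: eventually_sequentially)
    define k where "k = max N N'"
    \<comment> \<open>The displacement is known only for \<open>f m\<close> at \<open>x m\<close>
      with the same \<open>m\<close>; \<open>k \<le> r k\<close> transfers the threshold
      \<open>N'\<close> to the subsequence.\<close>
    define m where "m = r k"
    have "N' \<le> m" using seq_suble[OF r, of k] by (simp add: m_def k_def)
    have "chordal (f m (x m)) (f m x0)
        \<le> chordal (f m (x m)) (g (x m)) + chordal (g (x m)) (f m x0)"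
      by (rule chordal.triangle) auto
    also have "chordal (g (x m)) (f m x0) \<le> chordal (g (x m)) (g x0) + chordal (g x0) (f m x0)"
      by (rule chordal.triangle) auto
    finally have "chordal (f m (x m)) (f m x0) \<le> chordal (f m (x m)) (g (x m))
        + (chordal (g (x m)) (g x0) + chordal (f m x0) (g x0))"
      by (simp add: chordal.commute)
    moreover have "chordal (f m (x m)) (g (x m)) < \<eta> / 4" "chordal (f m x0) (g x0) < \<eta> / 4"
      using N[rule_format, of k] by (auto simp: m_def k_def)
    moreover note N'[OF \<open>N' \<le> m\<close>]
    ultimately show False using \<eta>(2)[of m] \<eta>(1) by linarith
  qed
qed

section \<open>Integrability against the spherical measure\<close>

text \<open>A substitute for polar coordinates: \<open>f\<close> is dominated by a series of
  constants on balls, each ball standing for a dyadic shell, and the volumes make the integrated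
  series geometric.\<close>

lemma nn_integral_dyadic_finite:
  fixes f :: "real^'n \<Rightarrow> ennreal"
  assumes f: "\<And>x. f x = 0 \<or> (\<exists>j. x \<in> cball a (r j) \<and> f x \<le> ennreal (c j))"
    and r: "\<And>j. 0 \<le> r j" and c: "\<And>j. 0 \<le> c j"
    and K: "\<And>j. c j * r j ^ CARD('n) \<le> K * (1 / 2) ^ j"
  shows "(\<integral>\<^sup>+x. f x \<partial>lebesgue) < \<infinity>"
proof -
  define V where "V = unit_ball_vol (real CARD('n))"
  have V: "V \<ge> 0" by (simp add: V_def)
  have "K \<ge> 0" using K[of 0] c[of 0] r[of 0] by (smt (verit) mult_nonneg_nonneg power_0 zero_le_power mult_cancel_left2 mult.commute)
  have "f x \<le> (\<Sum>j. ennreal (c j) * indicator (cball a (r j)) x)" for x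
  proof (cases "f x = 0")
    case False
    then obtain j where j: "x \<in> cball a (r j)" "f x \<le> ennreal (c j)" using f by blast
    then have "f x \<le> (\<Sum>i\<in>{j}. ennreal (c i) * indicator (cball a (r i)) x)" by simp
    also have "\<dots> \<le> (\<Sum>j. ennreal (c j) * indicator (cball a (r j)) x)"
      by (rule sum_le_suminf) auto
    finally show ?thesis .
  qed simp
  then have "(\<integral>\<^sup>+x. f x \<partial>lebesgue) \<le> (\<integral>\<^sup>+x. (\<Sum>j. ennreal (c j) * indicator (cball a (r j)) x) \<partial>lebesgue)"
    by (intro nn_integral_mono) auto
  also have "\<dots> = (\<Sum>j. \<integral>\<^sup>+x. ennreal (c j) * indicator (cball a (r j)) x \<partial>lebesgue)"
    by (intro nn_integral_suminf borel_measurable_times_ennreal borel_measurable_indicator) auto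
  also have "\<dots> = (\<Sum>j. ennreal (c j * (V * r j ^ CARD('n))))"
    using r c V by (intro suminf_cong, subst nn_integral_cmult_indicator)
      (auto simp: emeasure_cball V_def ennreal_mult')
  also have "\<dots> \<le> (\<Sum>j. ennreal (V * K * (1 / 2) ^ j))"
  proof (intro suminf_le ennreal_leI)
    show "c j * (V * r j ^ CARD('n)) \<le> V * K * (1 / 2) ^ j" for j
      using mult_left_mono[OF K[of j] V] by (simp add: mult_ac)
  qed auto
  also have "\<dots> = ennreal (\<Sum>j. V * K * (1 / 2) ^ j)"
    using V \<open>K \<ge> 0\<close> by (intro suminf_ennreal2) (auto intro!: summable_mult summable_geometric)
  also have "\<dots> < \<infinity>" by simp
  finally show ?thesis .
qed

text \<open>On the shell with outer radius \<open>2^j\<close> the integrand is of order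
  \<open>2^j * 4^(-jn)\<close> and the ball has volume of order \<open>2^(jn)\<close>. The product
  \<open>2^(j(1-n))\<close> is summable since \<open>n \<ge> 2\<close>.\<close>

lemma spherical_first_moment_finite:
  assumes "CARD('n) \<ge> 2"
  shows "(\<integral>\<^sup>+(x::real^'n). ennreal ((1 + norm x) * (1 / (1 + (norm x)\<^sup>2) ^ CARD('n))) \<partial>lebesgue) < \<infinity>"
proof (rule nn_integral_dyadic_finite[where a=0 and r="\<lambda>j. 2 ^ j" and c="\<lambda>j. 2 * 2 ^ j * (4 / 4 ^ j) ^ CARD('n)"
      and K="2 * 4 ^ CARD('n)"])
  fix x :: "real^'n"
  define j where "j = (LEAST j. norm x \<le> 2 ^ j)"
  have "\<exists>j. norm x \<le> 2 ^ j"
    using real_arch_pow[of 2 "norm x"] by (auto intro: less_imp_le)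
  then have j: "norm x \<le> 2 ^ j" unfolding j_def by (rule LeastI_ex)
  have "4 ^ j \<le> 4 * (1 + (norm x)\<^sup>2)"
  proof (cases j)
    case (Suc i)
    have "\<not> norm x \<le> 2 ^ i" using not_less_Least[of i "\<lambda>j. norm x \<le> 2 ^ j"] Suc by (simp add: j_def)
    then have "(2 ^ i)\<^sup>2 \<le> (norm x)\<^sup>2" by (intro power_mono) auto
    moreover have "((2::real) ^ i)\<^sup>2 = 4 ^ i" by (simp add: power2_eq_square flip: power_mult_distrib)
    ultimately show ?thesis using Suc by simp
  qed simp
  then have "4 ^ j / 4 \<le> 1 + (norm x)\<^sup>2" by simp
  then have "1 / (1 + (norm x)\<^sup>2) \<le> 4 / 4 ^ j"
    using frac_le[of 1 1 "4 ^ j / 4" "1 + (norm x)\<^sup>2"] by simp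
  then have "(1 / (1 + (norm x)\<^sup>2)) ^ CARD('n) \<le> (4 / 4 ^ j) ^ CARD('n)"
    by (intro power_mono) auto
  moreover have "1 + norm x \<le> 2 * 2 ^ j" using j one_le_power[of "2::real" j] by linarith
  ultimately have "(1 + norm x) * (1 / (1 + (norm x)\<^sup>2)) ^ CARD('n) \<le> 2 * 2 ^ j * (4 / 4 ^ j) ^ CARD('n)"
    by (intro mult_mono) auto
  then show "ennreal ((1 + norm x) * (1 / (1 + (norm x)\<^sup>2) ^ CARD('n))) = 0 \<or>
    (\<exists>j. x \<in> cball 0 (2 ^ j) \<and> ennreal ((1 + norm x) * (1 / (1 + (norm x)\<^sup>2) ^ CARD('n)))
        \<le> ennreal (2 * 2 ^ j * (4 / 4 ^ j) ^ CARD('n)))"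
    using j by (intro disjI2 exI[of _ j]) (auto simp: power_one_over intro!: ennreal_leI)
next
  fix j
  define n where "n = CARD('n)"
  obtain k where k: "n = k + 2" using assms by (metis n_def add.commute le_Suc_ex)
  have e4: "(4::real) ^ j = 2 ^ j * 2 ^ j" by (simp flip: power_mult_distrib)
  have t: "(2::real) ^ j \<ge> 1" by simp
  have "(2 ^ j::real) * 2 ^ j \<le> (2 ^ j) ^ n"
    using power_increasing[of 2 n "(2::real) ^ j"] t k by (simp add: power2_eq_square)
  then have "(2 ^ j::real) / (2 ^ j) ^ n \<le> 1 / 2 ^ j"
    by (simp add: field_simps)
  moreover have "2 * 2 ^ j * (4 / 4 ^ j) ^ n * (2 ^ j) ^ n = (2 * 4 ^ n) * ((2 ^ j::real) / (2 ^ j) ^ n)"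
    unfolding e4 by (simp add: power_divide power_mult_distrib field_simps)
  moreover note mult_left_mono[OF calculation(1), of "2 * 4 ^ n"]
  ultimately show "2 * 2 ^ j * (4 / 4 ^ j) ^ CARD('n) * (2 ^ j) ^ CARD('n) \<le> 2 * 4 ^ CARD('n) * (1 / 2 :: real) ^ j"
    unfolding n_def[symmetric] by (simp add: power_one_over)
qed auto

text \<open>On the shell with outer radius \<open>2^(-j)\<close> the pole is at most
  \<open>2 * 2^j\<close>, against a volume of order \<open>2^(-jn)\<close>; again
  \<open>n \<ge> 2\<close> gives a geometric series. At \<open>x = c\<close> the integrand is 0,
  division by 0 being 0.\<close>

lemma local_inverse_norm_finite:
  fixes c :: "real^'n"
  assumes "CARD('n) \<ge> 2"
  shows "(\<integral>\<^sup>+x. ennreal (1 / norm (x - c)) * indicator (cball c 1) x \<partial>lebesgue) < \<infinity>"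
proof (rule nn_integral_dyadic_finite[where a=c and r="\<lambda>j. (1 / 2) ^ j" and c="\<lambda>j. 2 * 2 ^ j" and K=2])
  fix x :: "real^'n"
  show "ennreal (1 / norm (x - c)) * indicator (cball c 1) x = 0 \<or>
      (\<exists>j. x \<in> cball c ((1 / 2) ^ j) \<and> ennreal (1 / norm (x - c)) * indicator (cball c 1) x \<le> ennreal (2 * 2 ^ j))"
  proof (cases "x \<noteq> c \<and> x \<in> cball c 1")
    case True
    define j where "j = (LEAST j. (1 / 2) ^ Suc j < norm (x - c))"
    have "\<exists>j. (1 / 2) ^ j < norm (x - c)"
      using True by (intro real_arch_pow_inv) auto
    then obtain i where "(1 / 2) ^ i < norm (x - c)" ..
    moreover have "(1 / 2 :: real) ^ Suc i \<le> (1 / 2) ^ i" by simp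
    ultimately have "\<exists>j. (1 / 2) ^ Suc j < norm (x - c)" by (meson order.strict_trans1)
    then have j: "(1 / 2) ^ Suc j < norm (x - c)" unfolding j_def by (rule LeastI_ex)
    have "norm (x - c) \<le> (1 / 2) ^ j"
    proof (cases j)
      case 0
      then show ?thesis using True by (simp add: dist_norm norm_minus_commute)
    next
      case (Suc i)
      then show ?thesis using not_less_Least[of i "\<lambda>j. (1 / 2) ^ Suc j < norm (x - c)"] by (simp add: j_def)
    qed
    moreover have "1 / norm (x - c) \<le> 2 * 2 ^ j"
      using j True by (simp add: field_simps power_one_over)
    ultimately show ?thesis
      using True by (intro disjI2 exI[of _ j]) (auto simp: dist_norm norm_minus_commute intro!: ennreal_leI)
  qed auto
next
  fix j
  have "((1 / 2) ^ j) ^ CARD('n) \<le> ((1 / 2 :: real) ^ j) ^ 2"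
    using assms by (intro power_decreasing) (auto simp: power_le_one)
  then have "2 * 2 ^ j * ((1 / 2) ^ j) ^ CARD('n) \<le> 2 * 2 ^ j * ((1 / 2 :: real) ^ j) ^ 2"
    by (intro mult_left_mono) auto
  also have "\<dots> = 2 * (1 / 2) ^ j"
    by (simp add: power2_eq_square power_one_over)
  finally show "2 * 2 ^ j * ((1 / 2) ^ j) ^ CARD('n) \<le> 2 * (1 / 2 :: real) ^ j" .
qed auto

lemma spherical_inverse_norm_finite:
  fixes c :: "real^'n"
  assumes "CARD('n) \<ge> 2"
  shows "(\<integral>\<^sup>+x. ennreal (1 / norm (x - c) * (1 / (1 + (norm x)\<^sup>2) ^ CARD('n))) \<partial>lebesgue) < \<infinity>"
proof -
  let ?W = "\<lambda>x::real^'n. 1 / (1 + (norm x)\<^sup>2) ^ CARD('n)"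
  have W: "0 \<le> ?W x" "?W x \<le> 1" for x
  proof -
    have "1 \<le> (1 + (norm x)\<^sup>2) ^ CARD('n)" by (rule one_le_power) simp
    then have "0 < (1 + (norm x)\<^sup>2) ^ CARD('n)" by (rule order.strict_trans2[OF zero_less_one])
    then show "0 \<le> ?W x" "?W x \<le> 1"
      using \<open>1 \<le> (1 + (norm x)\<^sup>2) ^ CARD('n)\<close> by (simp_all only: zero_le_divide_1_iff divide_le_eq_1_pos less_imp_le)
  qed
  have "ennreal (1 / norm (x - c) * ?W x)
      \<le> ennreal (1 / norm (x - c)) * indicator (cball c 1) x + ennreal ((1 + norm x) * ?W x)" for x
  proof (cases "x \<in> cball c 1")
    case True
    have "1 / norm (x - c) * ?W x \<le> 1 / norm (x - c)"
      using mult_left_mono[OF W(2)[of x], of "1 / norm (x - c)"] by simp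
    then show ?thesis using True by (simp add: ennreal_leI add_increasing2)
  next
    case False
    then have "1 / norm (x - c) \<le> 1" by (simp add: dist_norm norm_minus_commute divide_le_eq_1)
    then have "1 / norm (x - c) * ?W x \<le> (1 + norm x) * ?W x"
      using W(1)[of x] norm_ge_zero[of x] by (intro mult_right_mono) linarith+
    then show ?thesis using False by (simp add: ennreal_leI)
  qed
  then have "(\<integral>\<^sup>+x. ennreal (1 / norm (x - c) * ?W x) \<partial>lebesgue)
    \<le> (\<integral>\<^sup>+x. ennreal (1 / norm (x - c)) * indicator (cball c 1) x + ennreal ((1 + norm x) * ?W x) \<partial>lebesgue)"
    by (intro nn_integral_mono) auto
  also have "\<dots> = (\<integral>\<^sup>+x. ennreal (1 / norm (x - c)) * indicator (cball c 1) x \<partial>lebesgue)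
      + (\<integral>\<^sup>+x. ennreal ((1 + norm x) * ?W x) \<partial>lebesgue)"
    by (intro nn_integral_add measurable_completion borel_measurable_times_ennreal borel_measurable_indicator) auto
  also have "\<dots> < \<infinity>"
    using local_inverse_norm_finite[OF assms, of c] spherical_first_moment_finite[OF assms] by simp
  finally show ?thesis .
qed

text \<open>The first integral bounds the energy of a stretching around a finite point, the second
  that of one around infinity.\<close>

lemma spherical_bound_finite:
  fixes c :: "real^'n"
  assumes n: "CARD('n) \<ge> 2" and C: "0 \<le> C" "0 \<le> \<epsilon>"
  shows "(\<integral>\<^sup>+x. ennreal (C * (1 + \<epsilon> / norm (x - c))) * ennreal (1 / (1 + (norm x)\<^sup>2) ^ CARD('n)) \<partial>lebesgue) < \<infinity>"
    "(\<integral>\<^sup>+x. ennreal (C * (1 + norm (x - c))) * ennreal (1 / (1 + (norm x)\<^sup>2) ^ CARD('n)) \<partial>lebesgue) < \<infinity>"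
proof -
  let ?W = "\<lambda>x::real^'n. 1 / (1 + (norm x)\<^sup>2) ^ CARD('n)"
  have W: "0 \<le> ?W x" for x by (auto intro!: divide_nonneg_nonneg zero_le_power add_nonneg_nonneg)
  have m1: "(\<lambda>x. ennreal ((1 + norm x) * ?W x)) \<in> borel_measurable lebesgue"
    by (intro measurable_completion) auto
  have m2: "(\<lambda>x. ennreal (1 / norm (x - c) * ?W x)) \<in> borel_measurable lebesgue"
    by (intro measurable_completion) auto
  have "ennreal (C * (1 + \<epsilon> / norm (x - c))) * ennreal (?W x)
      \<le> ennreal C * ennreal ((1 + norm x) * ?W x) + ennreal (C * \<epsilon>) * ennreal (1 / norm (x - c) * ?W x)" for x
  proof -
    have "C * (1 + \<epsilon> / norm (x - c)) * ?W x = C * (1 * ?W x) + (C * \<epsilon>) * (1 / norm (x - c) * ?W x)"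
      by (simp add: algebra_simps add_divide_distrib)
    also have "\<dots> \<le> C * ((1 + norm x) * ?W x) + (C * \<epsilon>) * (1 / norm (x - c) * ?W x)"
      using C W[of x] by (intro add_right_mono mult_left_mono mult_right_mono) auto
    finally have "ennreal (C * (1 + \<epsilon> / norm (x - c)) * ?W x)
        \<le> ennreal (C * ((1 + norm x) * ?W x) + (C * \<epsilon>) * (1 / norm (x - c) * ?W x))"
      by (rule ennreal_leI)
    moreover have "0 \<le> 1 / norm (x - c) * ?W x" "0 \<le> (1 + norm x) * ?W x"
      using W[of x] by (auto intro!: mult_nonneg_nonneg)
    moreover have "0 \<le> C * (1 + \<epsilon> / norm (x - c))" using C by simp
    ultimately show ?thesis
      using C W[of x] by (simp only: ennreal_mult ennreal_plus mult_nonneg_nonneg)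
  qed
  then have "(\<integral>\<^sup>+x. ennreal (C * (1 + \<epsilon> / norm (x - c))) * ennreal (?W x) \<partial>lebesgue)
     \<le> (\<integral>\<^sup>+x. ennreal C * ennreal ((1 + norm x) * ?W x) + ennreal (C * \<epsilon>) * ennreal (1 / norm (x - c) * ?W x) \<partial>lebesgue)"
    by (intro nn_integral_mono) auto
  also have "\<dots> = ennreal C * (\<integral>\<^sup>+x. ennreal ((1 + norm x) * ?W x) \<partial>lebesgue)
      + ennreal (C * \<epsilon>) * (\<integral>\<^sup>+x. ennreal (1 / norm (x - c) * ?W x) \<partial>lebesgue)"
    using m1 m2 by (subst nn_integral_add) (auto simp: nn_integral_cmult)
  also have "\<dots> < \<infinity>"
    using spherical_first_moment_finite[OF n] spherical_inverse_norm_finite[OF n, of c]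
    by (simp add: ennreal_mult_less_top)
  finally show "(\<integral>\<^sup>+x. ennreal (C * (1 + \<epsilon> / norm (x - c))) * ennreal (?W x) \<partial>lebesgue) < \<infinity>" .
  have "ennreal (C * (1 + norm (x - c))) * ennreal (?W x)
      \<le> ennreal (C * (1 + norm c)) * ennreal ((1 + norm x) * ?W x)" for x
  proof -
    have "(1 + norm c) * (1 + norm x) = 1 + norm c + norm x + norm c * norm x"
      by (simp add: algebra_simps)
    then have "1 + norm (x - c) \<le> (1 + norm c) * (1 + norm x)"
      using norm_triangle_ineq4[of x c] mult_nonneg_nonneg[OF norm_ge_zero[of c] norm_ge_zero[of x]]
      by linarith
    then have "C * (1 + norm (x - c)) * ?W x \<le> C * ((1 + norm c) * (1 + norm x)) * ?W x"
      using C W[of x] by (intro mult_right_mono mult_left_mono) auto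
    then have "ennreal (C * (1 + norm (x - c)) * ?W x) \<le> ennreal (C * (1 + norm c) * ((1 + norm x) * ?W x))"
      by (intro ennreal_leI) (simp add: mult.assoc)
    moreover have "0 \<le> (1 + norm x) * ?W x" "0 \<le> C * (1 + norm (x - c))" "0 \<le> C * (1 + norm c)"
      using W[of x] C by (auto intro!: mult_nonneg_nonneg)
    ultimately show ?thesis
      using W[of x] by (simp only: ennreal_mult)
  qed
  then have "(\<integral>\<^sup>+x. ennreal (C * (1 + norm (x - c))) * ennreal (?W x) \<partial>lebesgue)
     \<le> (\<integral>\<^sup>+x. ennreal (C * (1 + norm c)) * ennreal ((1 + norm x) * ?W x) \<partial>lebesgue)"
    by (intro nn_integral_mono) auto
  also have "\<dots> = ennreal (C * (1 + norm c)) * (\<integral>\<^sup>+x. ennreal ((1 + norm x) * ?W x) \<partial>lebesgue)"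
    using m1 by (rule nn_integral_cmult)
  also have "\<dots> < \<infinity>"
    using spherical_first_moment_finite[OF n] by (simp add: ennreal_mult_less_top)
  finally show "(\<integral>\<^sup>+x. ennreal (C * (1 + norm (x - c))) * ennreal (?W x) \<partial>lebesgue) < \<infinity>" .
qed

section \<open>Concentrating homeomorphisms\<close>

text \<open>Since the centre will be a point of \<open>D\<close>, the stretching has to become a
  similarity near it. The modification leaves the profile unchanged down to \<open>- m\<close>,
  hence also the lower bound for the modulus at this level.\<close>

lemma exists_truncated_profile:
  fixes v :: "real \<Rightarrow> real"
  assumes v: "continuous_on UNIV v" "\<And>s. 0 < v s" "\<And>s. v s \<le> 1" "\<And>s. 0 \<le> s \<Longrightarrow> v s = 1"
    and L: "\<And>t. 0 \<le> t \<Longrightarrow> integral {- t..0} v \<le> L" and m: "0 \<le> m"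
  obtains u Q and q :: real where "continuous_on UNIV u" "\<And>s. v s \<le> u s" "\<And>s. u s \<le> 1"
    "\<And>s. (Q has_real_derivative (u s - 1)) (at s)" "\<And>s. 0 \<le> s \<Longrightarrow> Q s = 0"
    "- L \<le> - m + Q (- m)" "\<And>s. s \<le> - m - 1 \<Longrightarrow> Q s = q"
proof -
  \<comment> \<open>The ramp \<open>- s - m\<close> is non-positive for \<open>s \<ge> - m\<close>,
    where \<open>u = v\<close>, and at least 1 for \<open>s \<le> - m - 1\<close>, where
    \<open>u = 1\<close> and \<open>Q\<close> is constant.\<close>
  define u where "u s = max (v s) (min 1 (- s - m))" for s
  have u: "continuous_on UNIV u" unfolding u_def by (intro continuous_intros v(1))
  have u1: "u s = 1" if "0 \<le> s" for s using v(4)[OF that] by (simp add: u_def)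
  show thesis
  proof (rule exists_antiderivative[OF u u1])
    fix Q
    assume Q: "\<And>s. (Q has_real_derivative (u s - 1)) (at s)" "\<And>s. 0 \<le> s \<Longrightarrow> Q s = 0"
      "\<And>t. 0 \<le> t \<Longrightarrow> Q (- t) = t - integral {- t..0} u"
    have "integral {- m..0} u = integral {- m..0} v"
    proof (rule integral_cong)
      fix s assume "s \<in> {- m..0}"
      then have "min 1 (- s - m) \<le> v s" using v(2)[of s] by (simp add: min_le_iff_disj)
      then show "u s = v s" by (simp add: u_def)
    qed
    then have lower: "- L \<le> - m + Q (- m)" using Q(3)[OF m] L[OF m] by simp
    have "(Q has_real_derivative 0) (at s within {..- m - 1})" if "s \<in> {..- m - 1}" for s
    proof -
      have "u s = 1" using that v(3)[of s] by (auto simp: u_def)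
      then show ?thesis using Q(1)[of s] by (auto intro: has_field_derivative_at_within)
    qed
    then obtain q where q: "\<And>s. s \<in> {..- m - 1} \<Longrightarrow> Q s = q"
      using has_field_derivative_zero_constant[of "{..- m - 1}" Q] by (auto simp: convex_real_interval)
    show thesis
      by (rule that[OF u _ _ Q(1,2) lower]) (use q v(3) in \<open>auto simp: u_def\<close>)
  qed auto
qed

text \<open>\<open>G\<close> is the fixed map with a cavity at the missing point \<open>p\<close>;
  the sequence consists of \<open>G\<close> composed with stretchings that move points only in the
  ball of radius \<epsilon> about \<open>x0\<close>. As \<open>G\<close> is the identity on the ball
  of twice this radius, every point of \<open>D\<close> has a neighbourhood on which the composition
  equals one of the two factors, and no chain rule for dilatations is needed.\<close>

lemma concentrating_maps:
  fixes D :: "(real^'n) option set" and \<Phi> :: "ennreal \<Rightarrow> ennreal" and G :: "real^'n \<Rightarrow> real^'n"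
  assumes n: "CARD('n) \<ge> 2" and mono: "mono \<Phi>"
    and v: "continuous_on UNIV v" "\<And>s. 0 < v s" "\<And>s. v s \<le> 1" "\<And>s. 0 \<le> s \<Longrightarrow> v s = 1"
    and L: "\<And>t. 0 \<le> t \<Longrightarrow> integral {- t..0} v \<le> L"
    and C: "0 \<le> C" "\<And>s. \<Phi> (ennreal (1 / v s ^ (CARD('n) - 1))) \<le> ennreal (C * exp (max 0 (- s)))"
    and D: "openin xtop D" "Some x0 \<in> D" and \<epsilon>: "0 < \<epsilon>"
    and p: "p \<notin> D" "\<And>p0. p = Some p0 \<Longrightarrow> \<epsilon> \<le> norm (p0 - x0)"
    and G: "\<And>x. norm (x - x0) < 2 * \<epsilon> \<Longrightarrow> G x = x" "inj G"
      "\<And>x. Some x \<noteq> p \<Longrightarrow> regular_at G x"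
      "p \<noteq> None \<Longrightarrow> \<exists>R. \<forall>x. norm x > R \<longrightarrow> G x = x"
    and q: "q1 \<noteq> q2" "q1 \<notin> map_option G ` (- {p})" "q2 \<notin> map_option G ` (- {p})"
    and h: "\<And>x. Some x \<noteq> p \<Longrightarrow> \<Phi> (K_I G x) \<le> ennreal (h x)" "h \<in> borel_measurable borel"
      "(\<integral>\<^sup>+x. ennreal (h x) * ennreal (1 / (1 + (norm x)\<^sup>2) ^ CARD('n)) \<partial>lebesgue) < \<infinity>"
  obtains M \<Delta> where "0 < M" "0 < \<Delta>" "\<Delta> < 1"
    "\<not> equicontinuous_fam D (S_class D \<Phi> M \<Delta>)" "\<not> normal_fam D (S_class D \<Phi> M \<Delta>)"
proof -
  let ?W = "\<lambda>x::real^'n. ennreal (1 / (1 + (norm x)\<^sup>2) ^ CARD('n))"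
  \<comment> \<open>The sum dominates the energy densities of both factors and does not depend on
    the index of the map, so a single \<open>M\<close> works for the whole sequence.\<close>
  define B where "B x = ennreal (C * (1 + \<epsilon> / norm (x - x0))) + ennreal (h x)" for x
  define I where "I = (\<integral>\<^sup>+x. B x * ?W x \<partial>lebesgue)"
  have "I = (\<integral>\<^sup>+x. ennreal (C * (1 + \<epsilon> / norm (x - x0))) * ?W x \<partial>lebesgue) + (\<integral>\<^sup>+x. ennreal (h x) * ?W x \<partial>lebesgue)"
    unfolding I_def B_def distrib_right
    by (rule nn_integral_add; intro measurable_completion) (use h(2) in auto)
  then have Ifin: "I < \<infinity>"
    using spherical_bound_finite(1)[OF n C(1), of \<epsilon> x0] \<epsilon> h(3) by simp
  define M where "M = enn2real I + 1"
  have M: "0 < M" "I \<le> ennreal M"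
  proof -
    show "0 < M" by (simp add: M_def add_nonneg_pos)
    have "I = ennreal (enn2real I)" using Ifin by simp
    also have "\<dots> \<le> ennreal M" by (rule ennreal_leI) (simp add: M_def)
    finally show "I \<le> ennreal M" .
  qed
  have chpos: "0 < chordal q1 q2" using q(1) chordal.mdist_pos_eq[of q1 q2] by simp
  \<comment> \<open>Chordal distances can reach 1, hence the minimum with 1/2.\<close>
  define \<Delta> where "\<Delta> = min (1 / 2) (chordal q1 q2)"
  have \<Delta>: "0 < \<Delta>" "\<Delta> < 1" using chpos by (auto simp: \<Delta>_def)
  obtain e :: "real^'n" where e: "norm e = 1" using vector_choose_size zero_le_one by blast
  define x where "x m = x0 + (\<epsilon> * exp (- real m)) *\<^sub>R e" for m :: nat
  have nx: "norm (x m - x0) = \<epsilon> * exp (- real m)" for m using \<epsilon> e by (simp add: x_def)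
  \<comment> \<open>The radius of the cavity that the untruncated stretching would leave, estimated
    from below by the bound \<open>L\<close> on the integral of the profile.\<close>
  define e' where "e' = \<epsilon> * exp (- L)"
  have e': "0 < e'" using \<epsilon> by (simp add: e'_def)
  have maps: "\<exists>g. map_option g \<in> S_class D \<Phi> M \<Delta> \<and> g x0 = x0 \<and> e' \<le> norm (x0 - g (x m))" for m
  proof (rule exists_truncated_profile[OF v L, of "real m"])
    fix u Q and q :: real
    assume u: "continuous_on UNIV u" "\<And>s. v s \<le> u s" "\<And>s. u s \<le> 1"
      and Q: "\<And>s. (Q has_real_derivative (u s - 1)) (at s)" "\<And>s. 0 \<le> s \<Longrightarrow> Q s = 0"
      "- L \<le> - real m + Q (- real m)" "\<And>s. s \<le> - real m - 1 \<Longrightarrow> Q s = q"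
    have upos: "0 < u s" for s using v(2)[of s] u(2)[of s] by linarith
    define S where "S r = Q (ln (r / \<epsilon>))" for r
    define w where "w r = u (ln (r / \<epsilon>))" for r
    define G1 where "G1 = radial_map x0 S"
    have S: "(S has_real_derivative (w r - 1) / r) (at r)" if "0 < r" for r
      unfolding S_def w_def by (rule inner_profile_deriv[OF Q(1) that \<epsilon>])
    have w: "0 < w r" "w r \<le> 1" for r using upos u(3) by (auto simp: w_def)
    have cw: "continuous_on {0<..} w"
      unfolding w_def by (rule continuous_on_inner_profile[OF u(1) \<epsilon>])
    have G1_id: "G1 y = y" if "\<epsilon> \<le> norm (y - x0)" for y
      unfolding G1_def using that \<epsilon> by (intro radial_map_ident) (simp add: S_def Q(2))
    have G1_inj: "inj G1" unfolding G1_def by (rule inj_radial_map[OF S w(1)])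
    have G1_x0: "G1 x0 = x0" by (simp add: G1_def radial_map_def)
    have const: "S r = q" if "0 < r" "r < \<epsilon> * exp (- real m - 1)" for r
    proof -
      have "ln (r / \<epsilon>) \<le> ln (exp (- real m - 1))"
        using that \<epsilon> by (intro ln_mono) (auto simp: field_simps)
      then show ?thesis by (simp add: S_def Q(4))
    qed
    have pos: "0 < \<epsilon> * exp (- real m - 1)" using \<epsilon> by simp
    have G1_reg: "regular_at G1 y" for y
      using radial_map_center_regular(1)[OF pos const, where c=x0] radial_map_regular[OF _ S w cw, where x=y and c=x0]
      unfolding G1_def by (cases "y = x0") auto
    have G1_K: "\<Phi> (K_I G1 y) \<le> ennreal (C * (1 + \<epsilon> / norm (y - x0)))" for y
    proof (cases "y = x0")
      case True
      have "K_I G1 y = 1"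
        using radial_map_center_regular(2)[OF pos const, where c=x0] True by (simp add: G1_def)
      then show ?thesis using C(2)[of 0] v(4)[of 0] True by simp
    next
      case False
      define s where "s = ln (norm (y - x0) / \<epsilon>)"
      have "K_I G1 y = ennreal (1 / u s ^ (CARD('n) - 1))"
        unfolding G1_def s_def using radial_map_K_I[OF False S w] by (simp add: w_def)
      moreover have "1 / u s ^ (CARD('n) - 1) \<le> 1 / v s ^ (CARD('n) - 1)"
        using u(2)[of s] v(2)[of s] upos[of s] by (intro divide_left_mono power_mono mult_pos_pos zero_less_power) auto
      ultimately have "\<Phi> (K_I G1 y) \<le> \<Phi> (ennreal (1 / v s ^ (CARD('n) - 1)))"
        by (simp only:) (intro monoD[OF mono] ennreal_leI)
      also have "\<dots> \<le> ennreal (C * exp (max 0 (- s)))" by (rule C(2))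
      also have "\<dots> \<le> ennreal (C * (1 + \<epsilon> / norm (y - x0)))"
        unfolding s_def using False \<epsilon> by (intro ennreal_leI mult_left_mono exp_max_ln_le C(1)) auto
      finally show ?thesis .
    qed
    define g where "g = G \<circ> G1"
    have G1_ball: "norm (G1 y - x0) < 2 * \<epsilon>" if "norm (y - x0) < 2 * \<epsilon>" for y
    proof (cases "\<epsilon> \<le> norm (y - x0)")
      case False
      have "norm (G1 y - x0) = exp (S (norm (y - x0))) * norm (y - x0)"
        unfolding G1_def by (rule norm_radial_map)
      also have "\<dots> < exp (S \<epsilon>) * \<epsilon>"
        using False by (intro radial_profile_less[OF S w(1)]) auto
      also have "\<dots> = \<epsilon>" using \<epsilon> by (simp add: S_def Q(2))
      finally show ?thesis using \<epsilon> by simp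
    qed (use that G1_id in simp)
    have g_in: "g y = G1 y" if "norm (y - x0) < 2 * \<epsilon>" for y
      using G(1)[OF G1_ball[OF that]] by (simp add: g_def)
    have g_out: "g y = G y" if "\<epsilon> \<le> norm (y - x0)" for y
      using G1_id[OF that] by (simp add: g_def)
    have open_in: "open {y. norm (y - x0) < 2 * \<epsilon>}" and open_out: "open {y. \<epsilon> < norm (y - x0)}"
      by (auto intro!: open_Collect_less continuous_intros)
    have reg: "regular_at g y" and K: "\<Phi> (K_I g y) \<le> B y" if "Some y \<noteq> p" for y
    proof -
      \<comment> \<open>On the annulus between the radii \<epsilon> and
        \<open>2 * \<epsilon>\<close> both factors are the identity, so the two open sets overlap
        and nothing has to be glued along a sphere.\<close>
      consider "norm (y - x0) < 2 * \<epsilon>" | "\<epsilon> < norm (y - x0)" using \<epsilon> by linarith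
      then have "regular_at g y \<and> \<Phi> (K_I g y) \<le> B y"
      proof cases
        case 1
        have "regular_at g y"
          by (rule regular_at_cong_open[OF open_in _ _ G1_reg]) (use 1 g_in in auto)
        moreover have "K_I g y = K_I G1 y"
          by (rule K_I_cong_open[OF open_in]) (use 1 g_in in auto)
        ultimately show ?thesis using G1_K[of y] by (auto simp: B_def intro: add_increasing2)
      next
        case 2
        have "regular_at g y"
          by (rule regular_at_cong_open[OF open_out _ _ G(3)[OF that]]) (use 2 g_out in auto)
        moreover have "K_I g y = K_I G y"
          by (rule K_I_cong_open[OF open_out]) (use 2 g_out in auto)
        ultimately show ?thesis using h(1)[OF that] by (auto simp: B_def intro: add_increasing)
      qed
      then show "regular_at g y" "\<Phi> (K_I g y) \<le> B y" by auto
    qed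
    \<comment> \<open>\<open>G1\<close> is injective and fixes \<open>p\<close>, so it maps no point
      of \<open>D\<close> to \<open>p\<close>; whatever \<open>G\<close> omits off \<open>p\<close>
      is then omitted by the composition on \<open>D\<close>.\<close>
    have avoid: "map_option g ` D \<subseteq> map_option G ` (- {p})"
    proof
      fix z assume "z \<in> map_option g ` D"
      then obtain d where d: "d \<in> D" "z = map_option g d" ..
      have "map_option G1 d \<noteq> p"
      proof
        assume eq: "map_option G1 d = p"
        show False
        proof (cases p)
          case (Some p0)
          then have "G1 p0 = p0" using p(2) G1_id by blast
          then have "d = p" using eq Some injD[OF G1_inj] by (cases d) auto
          then show ?thesis using d(1) p(1) by simp
        qed (use eq d(1) p(1) in \<open>cases d; auto\<close>)
      qed
      moreover have "z = map_option G (map_option G1 d)" using d(2) by (simp add: g_def option.map_comp)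
      ultimately show "z \<in> map_option G ` (- {p})" by blast
    qed
    have "map_option g \<in> S_class D \<Phi> M \<Delta>"
    proof (rule map_option_in_S_class[OF D(1)])
      show "inj_on g {x. Some x \<in> D}"
        unfolding g_def by (rule inj_on_subset[OF inj_compose[OF G(2) G1_inj]]) simp
      show "regular_at g y" if "Some y \<in> D" for y using reg[of y] that p(1) by auto
      show "\<exists>R. \<forall>x. norm x > R \<longrightarrow> g x = x" if "None \<in> D"
      proof -
        have "p \<noteq> None" using that p(1) by metis
        then obtain R where R: "\<And>x. norm x > R \<Longrightarrow> G x = x" using G(4) by blast
        have "g y = y" if "norm y > max R (norm x0 + \<epsilon>)" for y
        proof -
          have "\<epsilon> \<le> norm (y - x0)" using that norm_triangle_ineq2[of y x0] by simp
          then show ?thesis using g_out[of y] R[of y] that by simp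
        qed
        then show ?thesis by blast
      qed
      show "q1 \<notin> map_option g ` D" "q2 \<notin> map_option g ` D" using q avoid by auto
      show "\<Delta> \<le> chordal q1 q2" by (simp add: \<Delta>_def)
      have "(\<integral>\<^sup>+x\<in>{x. Some x \<in> D}. \<Phi> (K_I g x) * ?W x \<partial>lebesgue) \<le> I"
        unfolding I_def
      proof (rule nn_integral_mono)
        fix y
        show "\<Phi> (K_I g y) * ?W y * indicator {x. Some x \<in> D} y \<le> B y * ?W y"
          using K[of y] p(1) by (auto simp: indicator_def intro!: mult_right_mono)
      qed
      then show "(\<integral>\<^sup>+x\<in>{x. Some x \<in> D}. \<Phi> (K_I g x) * ?W x \<partial>lebesgue) \<le> ennreal M"
        using M(2) by (rule order_trans)
    qed
    moreover have "g x0 = x0" using g_in[of x0] G1_x0 \<epsilon> by simp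
    moreover have "e' \<le> norm (x0 - g (x m))"
    proof -
      have "norm (x m - x0) < 2 * \<epsilon>"
      proof -
        have "\<epsilon> * exp (- real m) \<le> \<epsilon> * 1" using \<epsilon> by (intro mult_left_mono) auto
        then show ?thesis using \<epsilon> nx[of m] by linarith
      qed
      then have "norm (g (x m) - x0) = exp (S (norm (x m - x0))) * norm (x m - x0)"
        using g_in[of "x m"] norm_radial_map[of x0 S "x m"] by (simp add: G1_def)
      \<comment> \<open>At \<open>x m\<close> the logarithmic radius is exactly \<open>- m\<close>,
        the last level that the truncation leaves untouched.\<close>
      also have "\<dots> = \<epsilon> * exp (- real m + Q (- real m))"
        unfolding exp_add using \<epsilon> by (simp add: nx S_def)
      also have "\<dots> \<ge> e'" unfolding e'_def using Q(3) \<epsilon> by simp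
      finally show ?thesis by (simp add: norm_minus_commute)
    qed
    ultimately show ?thesis by blast
  qed auto
  then obtain g where g: "\<And>m. map_option (g m) \<in> S_class D \<Phi> M \<Delta>" "\<And>m. g m x0 = x0"
      "\<And>m. e' \<le> norm (x0 - g m (x m))" by metis
  have lim: "limitin xtop (\<lambda>m. Some (x m)) (Some x0) sequentially"
    unfolding chordal.limitin_metric
  proof (intro conjI allI impI)
    fix \<gamma> :: real assume "0 < \<gamma>"
    have "(\<lambda>m. \<epsilon> * exp (- 1) ^ m) \<longlonglongrightarrow> \<epsilon> * 0"
      by (intro tendsto_intros LIMSEQ_power_zero) auto
    then have "(\<lambda>m. \<epsilon> * exp (- real m)) \<longlonglongrightarrow> 0"
      by (simp flip: exp_of_nat_mult)
    then have "\<forall>\<^sub>F m in sequentially. \<epsilon> * exp (- real m) < \<gamma>"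
      using \<open>0 < \<gamma>\<close> by (rule order_tendstoD)
    then show "\<forall>\<^sub>F m in sequentially. Some (x m) \<in> UNIV \<and> chordal (Some (x m)) (Some x0) < \<gamma>"
    proof (rule eventually_mono)
      fix m assume "\<epsilon> * exp (- real m) < \<gamma>"
      then show "Some (x m) \<in> UNIV \<and> chordal (Some (x m)) (Some x0) < \<gamma>"
        using chordal_Some_le[of "x m" x0] nx[of m] by (intro conjI UNIV_I) linarith
    qed
  qed simp
  then have "\<forall>\<^sub>F m in sequentially. Some (x m) \<in> D"
    using D by (auto simp: limitin_def)
  \<comment> \<open>The points \<open>x m\<close> are only eventually in the open set
    \<open>D\<close>; the sequence is therefore shifted by \<open>m0\<close>.\<close>
  then obtain m0 where m0: "\<And>m. m0 \<le> m \<Longrightarrow> Some (x m) \<in> D" by (auto simp: eventually_sequentially)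
  define \<eta> where "\<eta> = e' / (sqrt (1 + (norm x0)\<^sup>2) * (1 + norm x0 + e'))"
  have "\<eta> > 0"
    unfolding \<eta>_def using e' sqrt_norm_pos[of x0] norm_ge_zero[of x0]
    by (intro divide_pos_pos mult_pos_pos) linarith+
  have far: "\<eta> \<le> chordal (map_option (g m) (Some (x m))) (map_option (g m) (Some x0))" for m
    using chordal_Some_ge[OF g(3)[of m] e'] g(2)[of m] chordal.commute[of "Some x0" "Some (g m (x m))"]
    by (simp only: \<eta>_def option.map)
  have lim': "limitin xtop (\<lambda>m. Some (x (m + m0))) (Some x0) sequentially"
    using lim by (rule limitin_sequentially_offset)
  show thesis
    by (rule that[OF M(1) \<Delta>])
      (rule not_equicontinuous_not_normal[of "\<lambda>m. map_option (g (m + m0))" _ "\<lambda>m. Some (x (m + m0))" D "Some x0" \<eta>];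
        use g(1) m0 D(2) lim' \<open>\<eta> > 0\<close> far in auto)+
qed

theorem theorem5p1:
  fixes D :: "(real^'n) option set"
    and \<Phi> :: "ennreal \<Rightarrow> ennreal"
  assumes "CARD('n) \<ge> 2"
    and "xdomain D"
    and "D \<noteq> UNIV"
    and "mono \<Phi>"
    and "ext_convex \<Phi>"
    and "(\<forall>M \<Delta>. 0 < M \<and> 0 < \<Delta> \<and> \<Delta> < 1 \<longrightarrow> equicontinuous_fam D (S_class D \<Phi> M \<Delta>))
       \<or> (\<forall>M \<Delta>. 0 < M \<and> 0 < \<Delta> \<and> \<Delta> < 1 \<longrightarrow> normal_fam D (S_class D \<Phi> M \<Delta>))"
  shows "\<forall>\<delta>::real. \<Phi> 0 < ennreal \<delta> \<longrightarrow>
     (\<integral>\<^sup>+\<tau>\<in>{\<delta><..}. 1 / (ennreal \<tau> * ennpowr (gen_inv \<Phi> (ennreal \<tau>)) (1 / (real CARD('n) - 1))) \<partial>lebesgue) = \<infinity>"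
proof (intro allI impI, rule ccontr)
  fix \<delta> :: real
  assume fin: "(\<integral>\<^sup>+\<tau>\<in>{\<delta><..}. 1 / (ennreal \<tau> * ennpowr (gen_inv \<Phi> (ennreal \<tau>)) (1 / (real CARD('n) - 1))) \<partial>lebesgue) \<noteq> \<infinity>"
  note n = assms(1) and mono = assms(4)
  have D: "openin xtop D" "D \<noteq> {}" using assms(2) by (auto simp: xdomain_def)
  obtain e :: "real^'n" where e: "norm e = 1" using vector_choose_size zero_le_one by blast
  \<comment> \<open>The stretchings are Euclidean, so a finite centre is needed; an open set
    containing infinity also contains all points of large norm.\<close>
  obtain x0 where x0: "Some x0 \<in> D"
  proof (cases "None \<in> D")
    case True
    then obtain R where R: "\<And>x. norm x > R \<Longrightarrow> Some x \<in> D" using D(1) unfolding openin_xtop_iff by blast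
    have "norm ((\<bar>R\<bar> + 1) *\<^sub>R e) > R" using e by simp
    then show thesis using R that by blast
  next
    case False
    then show thesis using D(2) that by (metis ex_in_conv option.exhaust)
  qed
  obtain p where p: "p \<notin> D" using assms(3) by blast
  show False
  proof (rule exists_dilatation_profile[OF n mono fin])
    fix v :: "real \<Rightarrow> real" and L C
    assume v: "continuous_on UNIV v" "\<And>s. 0 < v s" "\<And>s. v s \<le> 1" "\<And>s. 0 \<le> s \<Longrightarrow> v s = 1"
      and L: "\<And>t. 0 \<le> t \<Longrightarrow> integral {- t..0} v \<le> L"
      and C: "0 \<le> C" "\<And>s. \<Phi> (ennreal (1 / v s ^ (CARD('n) - 1))) \<le> ennreal (C * exp (max 0 (- s)))"
    \<comment> \<open>Whichever alternative is assumed, it fails for the same pair \<open>M\<close>,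
      \<Delta>.\<close>
    have contra: False if "0 < M" "0 < \<Delta>" "\<Delta> < 1"
      "\<not> equicontinuous_fam D (S_class D \<Phi> M \<Delta>)" "\<not> normal_fam D (S_class D \<Phi> M \<Delta>)" for M \<Delta>
      using assms(6) that by blast
    show False
    proof (rule exists_antiderivative[OF v(1,4)])
      fix Q
      assume Q: "\<And>s. (Q has_real_derivative (v s - 1)) (at s)" "\<And>s. 0 \<le> s \<Longrightarrow> Q s = 0"
        "\<And>t. 0 \<le> t \<Longrightarrow> Q (- t) = t - integral {- t..0} v"
      have L0: "0 \<le> L" using L[of 0] by simp
      \<comment> \<open>A lower bound for the logarithm of the modulus at all scales: it keeps the
        cavity at the missing point open.\<close>
      have lower: "- L \<le> s + Q s" for s
        using Q(2)[of s] Q(3)[of "- s"] L[of "- s"] L0 by (cases "0 \<le> s") auto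
      show False
      proof (cases p)
        case (Some p0)
        \<comment> \<open>The quarter separates the supports: the ball of radius
          \<open>2 * \<epsilon>\<close> about \<open>x0\<close>, where \<open>G\<close> has to be
          the identity, stays clear of the ball of radius \<epsilon> about \<open>p0\<close>, where
          \<open>G\<close> acts.\<close>
        define \<epsilon> where "\<epsilon> = norm (p0 - x0) / 4"
        have \<epsilon>: "0 < \<epsilon>" using p x0 Some by (auto simp: \<epsilon>_def)
        define S where "S r = Q (ln (r / \<epsilon>))" for r
        define w where "w r = v (ln (r / \<epsilon>))" for r
        define G where "G = radial_map p0 S"
        have S: "(S has_real_derivative (w r - 1) / r) (at r)" if "0 < r" for r
          unfolding S_def w_def by (rule inner_profile_deriv[OF Q(1) that \<epsilon>])
        have w: "0 < w r" "w r \<le> 1" for r using v by (auto simp: w_def)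
        have cw: "continuous_on {0<..} w"
          unfolding w_def by (rule continuous_on_inner_profile[OF v(1) \<epsilon>])
        have G_id: "G x = x" if "\<epsilon> \<le> norm (x - p0)" for x
          unfolding G_def using that \<epsilon> by (intro radial_map_ident) (simp add: S_def Q(2))
        have G_ge: "\<epsilon> * exp (- L) \<le> norm (G x - p0)" if "x \<noteq> p0" for x
        proof -
          define s where "s = ln (norm (x - p0) / \<epsilon>)"
          have r: "norm (x - p0) = \<epsilon> * exp s" using that \<epsilon> by (simp add: s_def)
          have "norm (G x - p0) = \<epsilon> * exp (s + Q s)"
            unfolding G_def norm_radial_map S_def s_def[symmetric] by (simp add: r exp_add)
          then show ?thesis using lower[of s] \<epsilon> by simp
        qed
        show False
        \<comment> \<open>The cavity around \<open>p0\<close> has radius at least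
          \<open>\<epsilon> * exp (- L)\<close>; its centre and a point at half this radius are the
          two omitted points. As a total function \<open>G\<close> fixes \<open>p0\<close>, which is
          why \<open>p\<close> is excluded from the image.\<close>
        proof (rule concentrating_maps[OF n mono v L C D(1) x0 \<epsilon> p, of G "Some p0" "Some (p0 + (\<epsilon> * exp (- L) / 2) *\<^sub>R e)"
              "\<lambda>x. C * (1 + \<epsilon> / norm (x - p0))"])
          show "\<epsilon> \<le> norm (p1 - x0)" if "p = Some p1" for p1
            using that Some by (simp add: \<epsilon>_def)
          show "G x = x" if "norm (x - x0) < 2 * \<epsilon>" for x
          proof (rule G_id)
            have "norm (p0 - x0) \<le> norm (x - x0) + norm (x - p0)"
              using norm_triangle_ineq4[of "x - x0" "x - p0"] by (simp add: norm_minus_commute)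
            then show "\<epsilon> \<le> norm (x - p0)"
              using that norm_ge_zero[of "p0 - x0"] unfolding \<epsilon>_def by linarith
          qed
          show "inj G" unfolding G_def by (rule inj_radial_map[OF S w(1)])
          show "regular_at G x" if "Some x \<noteq> p" for x
            unfolding G_def using that Some by (intro radial_map_regular[OF _ S w cw]) auto
          show "\<exists>R. \<forall>x. norm x > R \<longrightarrow> G x = x"
          proof (intro exI allI impI G_id)
            show "\<epsilon> \<le> norm (x - p0)" if "norm x > norm p0 + \<epsilon>" for x
              using that norm_triangle_ineq2[of x p0] by simp
          qed
          show "Some p0 \<noteq> Some (p0 + (\<epsilon> * exp (- L) / 2) *\<^sub>R e)" using \<epsilon> e by auto
          show "Some p0 \<notin> map_option G ` (- {p})"
          proof
            assume "Some p0 \<in> map_option G ` (- {p})"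
            then obtain x where "x \<noteq> p0" "G x = p0" unfolding Some_in_map_option_image using Some by auto
            then show False using G_ge[of x] \<epsilon> by (simp add: mult_le_0_iff)
          qed
          show "Some (p0 + (\<epsilon> * exp (- L) / 2) *\<^sub>R e) \<notin> map_option G ` (- {p})"
          proof
            assume "Some (p0 + (\<epsilon> * exp (- L) / 2) *\<^sub>R e) \<in> map_option G ` (- {p})"
            then obtain x where "x \<noteq> p0" "G x = p0 + (\<epsilon> * exp (- L) / 2) *\<^sub>R e"
              unfolding Some_in_map_option_image using Some by auto
            then show False using G_ge[of x] \<epsilon> e by simp
          qed
          show "\<Phi> (K_I G x) \<le> ennreal (C * (1 + \<epsilon> / norm (x - p0)))" if "Some x \<noteq> p" for x
          proof -
            have x: "x \<noteq> p0" using that Some by simp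
            have "\<Phi> (K_I G x) = \<Phi> (ennreal (1 / v (ln (norm (x - p0) / \<epsilon>)) ^ (CARD('n) - 1)))"
              unfolding G_def using radial_map_K_I[OF x S w] by (simp add: w_def)
            also have "\<dots> \<le> ennreal (C * exp (max 0 (- ln (norm (x - p0) / \<epsilon>))))" by (rule C(2))
            also have "\<dots> \<le> ennreal (C * (1 + \<epsilon> / norm (x - p0)))"
              using x \<epsilon> by (intro ennreal_leI mult_left_mono exp_max_ln_le C(1)) auto
            finally show ?thesis .
          qed
          show "(\<lambda>x. C * (1 + \<epsilon> / norm (x - p0))) \<in> borel_measurable borel" by simp
          show "(\<integral>\<^sup>+x. ennreal (C * (1 + \<epsilon> / norm (x - p0))) * ennreal (1 / (1 + (norm x)\<^sup>2) ^ CARD('n)) \<partial>lebesgue) < \<infinity>"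
            using spherical_bound_finite(1)[OF n C(1)] \<epsilon> by simp
        qed (assumption | erule (4) contra)+
      next
        case None
        \<comment> \<open>The cavity is now at infinity: an outer stretching about
          \<open>x0\<close>, which is the identity in the ball of radius 2 and squeezes the whole
          space into the ball of radius \<open>2 * exp L\<close>. The 2 is the radius
          \<open>2 * \<epsilon>\<close> required for \<open>\<epsilon> = 1\<close>.\<close>
        define S where "S r = - Q (ln (2 / r))" for r
        define w where "w r = v (ln (2 / r))" for r
        define G where "G = radial_map x0 S"
        have S: "(S has_real_derivative (w r - 1) / r) (at r)" if "0 < r" for r
          unfolding S_def w_def by (rule outer_profile_deriv[OF Q(1) that]) simp
        have w: "0 < w r" "w r \<le> 1" for r using v by (auto simp: w_def)
        have cw: "continuous_on {0<..} w"
          unfolding w_def by (rule continuous_on_outer_profile[OF v(1)]) simp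
        have S0: "S r = 0" if "0 < r" "r < 2" for r using that by (simp add: S_def Q(2))
        have G_le: "norm (G x - x0) \<le> 2 * exp L" for x
        proof (cases "x = x0")
          case False
          define s where "s = ln (2 / norm (x - x0))"
          have r: "norm (x - x0) = 2 * exp (- s)" using False by (simp add: s_def exp_minus)
          have "norm (G x - x0) = 2 * exp (- (s + Q s))"
            unfolding G_def norm_radial_map S_def s_def[symmetric] by (simp add: r exp_diff exp_minus exp_add field_simps)
          then show ?thesis using lower[of s] by simp
        qed (simp add: G_def radial_map_def)
        show False
        \<comment> \<open>The omitted points are infinity itself and a point at distance 1 beyond
          the ball that contains the image of \<open>G\<close>.\<close>
        proof (rule concentrating_maps[OF n mono v L C D(1) x0 zero_less_one p, of G None "Some (x0 + (2 * exp L + 1) *\<^sub>R e)"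
              "\<lambda>x. C * (1 + norm (x - x0))"])
          show "1 \<le> norm (p1 - x0)" if "p = Some p1" for p1 using that None by simp
          show "G x = x" if "norm (x - x0) < 2 * 1" for x
          proof (cases "x = x0")
            case False
            then show ?thesis unfolding G_def using that by (intro radial_map_ident S0) auto
          qed (simp add: G_def radial_map_def)
          show "inj G" unfolding G_def by (rule inj_radial_map[OF S w(1)])
          show "regular_at G x" if "Some x \<noteq> p" for x
            unfolding G_def using radial_map_center_regular(1)[of 2 S 0 x0] S0 radial_map_regular[OF _ S w cw, where x=x and c=x0]
            by (cases "x = x0") auto
          show "\<exists>R. \<forall>x. norm x > R \<longrightarrow> G x = x" if "p \<noteq> None" using that None by simp
          show "None \<noteq> Some (x0 + (2 * exp L + 1) *\<^sub>R e)" by simp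
          show "None \<notin> map_option G ` (- {p})" using None by auto
          show "Some (x0 + (2 * exp L + 1) *\<^sub>R e) \<notin> map_option G ` (- {p})"
          proof
            assume "Some (x0 + (2 * exp L + 1) *\<^sub>R e) \<in> map_option G ` (- {p})"
            then obtain x where "G x = x0 + (2 * exp L + 1) *\<^sub>R e"
              unfolding Some_in_map_option_image by auto
            then have "norm (G x - x0) = 2 * exp L + 1" using e by simp
            then show False using G_le[of x] by simp
          qed
          show "\<Phi> (K_I G x) \<le> ennreal (C * (1 + norm (x - x0)))" if "Some x \<noteq> p" for x
          proof (cases "x = x0")
            case True
            then have "K_I G x = 1" unfolding G_def using radial_map_center_regular(2)[of 2 S 0 x0] S0 by simp
            then show ?thesis using C(2)[of 0] v(4)[of 0] True by simp
          next
            case False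
            have "\<Phi> (K_I G x) = \<Phi> (ennreal (1 / v (ln (2 / norm (x - x0))) ^ (CARD('n) - 1)))"
              unfolding G_def using radial_map_K_I[OF False S w] by (simp add: w_def)
            also have "\<dots> \<le> ennreal (C * exp (max 0 (- ln (2 / norm (x - x0)))))" by (rule C(2))
            also have "\<dots> \<le> ennreal (C * (1 + norm (x - x0)))"
            proof (intro ennreal_leI mult_left_mono C(1))
              have "exp (max 0 (- ln (2 / norm (x - x0)))) \<le> 1 + norm (x - x0) / 2"
                using False by (intro exp_max_ln_le) auto
              then show "exp (max 0 (- ln (2 / norm (x - x0)))) \<le> 1 + norm (x - x0)"
                using norm_ge_zero[of "x - x0"] by linarith
            qed
            finally show ?thesis .
          qed
          show "(\<lambda>x. C * (1 + norm (x - x0))) \<in> borel_measurable borel" by simp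
          show "(\<integral>\<^sup>+x. ennreal (C * (1 + norm (x - x0))) * ennreal (1 / (1 + (norm x)\<^sup>2) ^ CARD('n)) \<partial>lebesgue) < \<infinity>"
            using spherical_bound_finite(2)[OF n C(1), of 0] by simp
        qed (assumption | erule (4) contra)+
      qed
    qed
  qed
qed

end
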